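(* Let $G$ be a simple, undirected, connected graph on $n\ge 2$ vertices with minimum degree $\delta$ and maximum degree $\Delta$, adjacency eigenvalues $\lambda_1\ge \dots \ge \lambda_n$, normalized adjacency eigenvalues $\sigma_1\ge \dots \ge \sigma_n$ and normalized Perron eigenvector $\nu$. Let $\nu_{\min} = \min_i \nu_i$, $\nu_{\max} = \max_i \nu_i$, $\lambda = \max\{|\lambda_2|,|\lambda_n|\}$ and $\sigma = \max\{|\sigma_2|,|\sigma_n|\}$. Then the zero forcing number $Z(G)$ satisfies (i) $Z(G) \ge n\left(1-\dfrac{2\sigma\Delta}{\delta\left(\delta/\Delta+\sigma\right)}\right)$; (ii) $Z(G) \ge n\left(1-\dfrac{2\lambda}{n(\lambda+\lambda_1)\nu_{\min}^2}\right)$; (iii) $Z(G) \ge n\left( 1-\dfrac{2\lambda}{\lambda_1(\nu_{\min}/\nu_{\max})^4 + \lambda}\right)$.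
   Context: Zero forcing: an initial subset of vertices is colored black and all other vertices white; repeatedly, a black vertex $v$ having exactly one white neighbor $w$ colors $w$ black. $Z(G)$ is the minimum cardinality of an initial black set from which the entire graph eventually becomes black. The adjacency eigenvalues are the eigenvalues of the adjacency matrix $A$; the normalized adjacency eigenvalues are the eigenvalues of $D^{-1/2}AD^{-1/2}$, where $D$ is the diagonal matrix of vertex degrees. The normalized Perron eigenvector $\nu$ is the unique eigenvector of $A$ for $\lambda_1$ with all entries positive and Euclidean norm $1$. *)

theory Defs
  imports
    "Graph_Theory.Digraph_Component"
    "Jordan_Normal_Form.Char_Poly"
begin

text \<open>
  A simple undirected graph is a term \<open>G\<close> with \<open>graph G\<close>: finite, loop-free, without parallel
  arcs, and with a symmetric arc relation, so that every edge is a pair of opposite arcs and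
  \<open>out_degree\<close> is the usual degree.
\<close>

inductive force :: "('a, 'b) pre_digraph \<Rightarrow> 'a set \<Rightarrow> 'a set \<Rightarrow> bool" for G where
  "v \<in> B \<Longrightarrow> {u. v \<rightarrow>\<^bsub>G\<^esub> u \<and> u \<notin> B} = {w} \<Longrightarrow> force G B (insert w B)"

definition zero_forcing_set :: "('a, 'b) pre_digraph \<Rightarrow> 'a set \<Rightarrow> bool" where
  "zero_forcing_set G B \<longleftrightarrow> B \<subseteq> verts G \<and> (force G)\<^sup>*\<^sup>* B (verts G)"

definition zero_forcing_number :: "('a, 'b) pre_digraph \<Rightarrow> nat" where
  "zero_forcing_number G = Min (card ` {B. zero_forcing_set G B})"

definition min_degree :: "('a, 'b) pre_digraph \<Rightarrow> nat" where
  "min_degree G = Min (out_degree G ` verts G)"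

definition max_degree :: "('a, 'b) pre_digraph \<Rightarrow> nat" where
  "max_degree G = Max (out_degree G ` verts G)"

text \<open>
  Matrices of a graph are taken with respect to a list \<open>vs\<close> enumerating its vertices without
  repetition.
\<close>

definition adj_matrix :: "('a, 'b) pre_digraph \<Rightarrow> 'a list \<Rightarrow> real mat" where
  "adj_matrix G vs =
     mat (length vs) (length vs) (\<lambda>(i, j). if vs ! i \<rightarrow>\<^bsub>G\<^esub> vs ! j then 1 else 0)"

definition inv_sqrt_degree_matrix :: "('a, 'b) pre_digraph \<Rightarrow> 'a list \<Rightarrow> real mat" where
  "inv_sqrt_degree_matrix G vs =
     mat_diag (length vs) (\<lambda>i. 1 / sqrt (real (out_degree G (vs ! i))))"

definition normalized_adj_matrix :: "('a, 'b) pre_digraph \<Rightarrow> 'a list \<Rightarrow> real mat" where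
  "normalized_adj_matrix G vs =
     inv_sqrt_degree_matrix G vs * adj_matrix G vs * inv_sqrt_degree_matrix G vs"

text \<open>
  Real eigenvalues, repeated according to their multiplicity as roots of the characteristic
  polynomial, in decreasing order. For a real symmetric matrix of size \<open>n\<close> the list has length
  \<open>n\<close>. Positions count from \<open>0\<close>: the \<open>k\<close>-th largest eigenvalue is \<open>eigvals A ! (k - 1)\<close>.
\<close>

definition eigvals :: "real mat \<Rightarrow> real list" where
  "eigvals A = rev (sorted_list_of_multiset (proots (char_poly A)))"

definition normalized_perron_vector :: "real mat \<Rightarrow> real vec \<Rightarrow> bool" where
  "normalized_perron_vector A v \<longleftrightarrow>
     eigenvector A v (eigvals A ! 0) \<and> (\<forall>i < dim_vec v. v $ i > 0) \<and> sqrt (v \<bullet> v) = 1"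

end

theory Submission
  imports Defs "Jordan_Normal_Form.Schur_Decomposition" "HOL-Analysis.L2_Norm"
begin

text \<open>
  A forcing process colouring \<open>t\<close> vertices consists of forces \<open>v\<^sub>0 \<rightarrow> w\<^sub>0, \<dots>, v\<^sub>t\<^sub>-\<^sub>1 \<rightarrow> w\<^sub>t\<^sub>-\<^sub>1\<close>
  such that \<open>v\<^sub>i\<close> is not adjacent to \<open>w\<^sub>j\<close> for \<open>i < j\<close>. Hence there is no edge between the first half
  of the \<open>v\<^sub>i\<close> and the last half of the \<open>w\<^sub>j\<close>, and an expander mixing inequality bounds \<open>t\<close>. If
  \<open>t\<close> is odd, the middle vertices \<open>v\<^sub>m\<close> and \<open>w\<^sub>m\<close> get weight \<open>1/2\<close> each. The edge between them
  then contributes a quarter of the corresponding matrix entry, and this is compensated by the loss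
  \<open>1/2 - (1/2)\<^sup>2 = 1/4\<close> in the norms of the two weight vectors, because every off-diagonal
  entry is at most \<open>\<bar>\<lambda>\<^sub>n\<bar>\<close>.

  Weighting the two halves by the Perron eigenvector \<open>\<nu>\<close> turns the mixing inequality into
  \<open>\<lambda>\<^sub>1 \<surd>(a b) \<le> \<lambda> \<surd>((1 - a)(1 - b))\<close>, where \<open>a\<close> and \<open>b\<close> are the \<open>\<nu>\<^sup>2\<close>-masses of the
  halves. All three bounds follow by estimating these masses, the first one for the normalized
  adjacency matrix, whose Perron eigenvector is proportional to the square roots of the degrees.
\<close>

section \<open>Real symmetric matrices\<close>

lemma real_symmetric_eigenvalue_real:
  fixes A :: "real mat"
  assumes A: "A \<in> carrier_mat n n" and sym: "A\<^sup>T = A"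
    and ev: "eigenvalue (map_mat complex_of_real A) a"
  shows "a \<in> \<real>"
proof -
  let ?C = "map_mat complex_of_real A"
  have C: "?C \<in> carrier_mat n n" using A by simp
  obtain v where v: "v \<in> carrier_vec n" "v \<noteq> 0\<^sub>v n" and Cv: "?C *\<^sub>v v = a \<cdot>\<^sub>v v"
    using ev A unfolding eigenvalue_def eigenvector_def by auto
  have cv: "conjugate v \<in> carrier_vec n" using v by simp
  have Csym: "?C\<^sup>T = ?C" using sym by (metis map_mat_transpose)
  have conj_mult: "?C *\<^sub>v conjugate v = conjugate (?C *\<^sub>v v)"
    using A v(1) by (intro eq_vecI) (auto simp: scalar_prod_def)
  \<comment> \<open>Symmetry moves \<open>?C\<close> onto \<open>conjugate v\<close>, and since its
    entries are real it acts there by \<open>cnj a\<close>. The Hermitian square of \<open>v\<close>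
    is nonzero and can be cancelled.\<close>
  have "a * (v \<bullet> conjugate v) = (?C *\<^sub>v v) \<bullet> conjugate v"
    using v cv by (simp add: Cv)
  also have "\<dots> = v \<bullet> (?C *\<^sub>v conjugate v)"
    using transpose_vec_mult_scalar[OF C cv v(1)] by (simp add: Csym)
  also have "\<dots> = cnj a * (v \<bullet> conjugate v)"
    using v cv by (simp add: conj_mult Cv conjugate_smult_vec)
  finally have "a * (v \<bullet>c v) = cnj a * (v \<bullet>c v)" .
  moreover have "v \<bullet>c v \<noteq> 0" using conjugate_square_eq_0_vec[OF v(1)] v(2) by simp
  ultimately show ?thesis by (metis mult_right_cancel Reals_cnj_iff)
qed

text \<open>Over the complex numbers the polynomial splits, and every root is an eigenvalue, hence
  real. So the factorization is the image of a real one under an injective map of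
  polynomials.\<close>

lemma real_symmetric_char_poly_splits:
  fixes A :: "real mat"
  assumes A: "A \<in> carrier_mat n n" and sym: "A\<^sup>T = A"
  shows "\<exists>es. char_poly A = (\<Prod>e\<leftarrow>es. [:- e, 1:])"
proof -
  interpret map_poly_inj_idom_hom complex_of_real ..
  let ?C = "map_mat complex_of_real A"
  have C: "?C \<in> carrier_mat n n" using A by simp
  obtain as where as: "char_poly ?C = (\<Prod>a\<leftarrow>as. [:- a, 1:])"
    using char_poly_factorized[OF C] by blast
  have "of_real (Re a) = a" if "a \<in> set as" for a
  proof -
    have "poly (char_poly ?C) a = 0" unfolding as using that
      by (auto simp: poly_prod_list prod_list_zero_iff)
    then have "eigenvalue ?C a" using eigenvalue_root_char_poly[OF C] by simp
    from real_symmetric_eigenvalue_real[OF A sym this] show ?thesis by simp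
  qed
  then have "(\<Prod>a\<leftarrow>as. [:- a, 1:]) = (\<Prod>a\<leftarrow>as. map_poly complex_of_real [:- Re a, 1:])"
    by (intro arg_cong[of _ _ prod_list] map_cong) (auto simp: map_poly_pCons)
  also have "\<dots> = map_poly complex_of_real (\<Prod>a\<leftarrow>as. [:- Re a, 1:])"
    by (simp add: hom_prod_list o_def)
  finally have "map_poly complex_of_real (char_poly A) = map_poly complex_of_real (\<Prod>a\<leftarrow>as. [:- Re a, 1:])"
    using as of_real_hom.char_poly_hom[OF A, where ?'a = complex] by simp
  then have "char_poly A = (\<Prod>a\<leftarrow>as. [:- Re a, 1:])"
    by (rule injectivity)
  then have "char_poly A = (\<Prod>e\<leftarrow>map Re as. [:- e, 1:])" by (simp add: o_def)
  then show ?thesis by blast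
qed

text \<open>\<open>proots\<close> counts real roots only; because the characteristic polynomial
  splits over the reals, none is lost. Later proofs reach \<open>eigvals\<close> through these four
  facts rather than through its definition.\<close>

lemma eigvals_char_poly:
  fixes A :: "real mat"
  assumes "A \<in> carrier_mat n n" and "A\<^sup>T = A"
  shows "char_poly A = (\<Prod>e\<leftarrow>eigvals A. [:- e, 1:])"
    and "length (eigvals A) = n"
    and "sorted_wrt (\<ge>) (eigvals A)"
    and "set (eigvals A) = {e. eigenvalue A e}"
proof -
  obtain es where es: "char_poly A = (\<Prod>e\<leftarrow>es. [:- e, 1:])"
    using real_symmetric_char_poly_splits[OF assms] by blast
  have "proots (char_poly A) = mset es"
    unfolding es
  proof (induction es)
    case (Cons a es)
    have "(\<Prod>e\<leftarrow>es. [:- e, 1:]) \<noteq> 0" by (auto simp: prod_list_zero_iff)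
    then have "proots ([:- a, 1:] * (\<Prod>e\<leftarrow>es. [:- e, 1:])) = proots [:- a, 1:] + mset es"
      using Cons.IH by (subst proots_mult) auto
    then show ?case by (simp del: mult_pCons_left)
  qed simp
  then have m: "mset (eigvals A) = mset es"
    by (simp add: eigvals_def)
  show 1: "char_poly A = (\<Prod>e\<leftarrow>eigvals A. [:- e, 1:])"
    unfolding es using arg_cong[OF m, of "\<lambda>M. prod_mset (image_mset (\<lambda>e. [:- e, 1:]) M)"]
    by (simp flip: prod_mset_prod_list)
  show "length (eigvals A) = n"
    using degree_monic_char_poly[OF assms(1)] degree_linear_factors[of uminus "eigvals A"]
    unfolding 1 by simp
  show "sorted_wrt (\<ge>) (eigvals A)"
    by (simp add: eigvals_def sorted_wrt_rev)
  show "set (eigvals A) = {e. eigenvalue A e}"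
    unfolding eigenvalue_root_char_poly[OF assms(1)] 1
    by (auto simp: poly_prod_list prod_list_zero_iff)
qed

text \<open>Extend \<open>v\<close> to a basis, apply Gram-Schmidt and normalize. The first column
  survives both operations because \<open>v\<close> comes first and already has norm 1.\<close>

lemma orthonormal_completion:
  fixes v :: "real vec"
  assumes v: "v \<in> carrier_vec n" and unit: "v \<bullet> v = 1"
  obtains W where "W \<in> carrier_mat n n" and "W\<^sup>T * W = 1\<^sub>m n" and "col W 0 = v"
proof -
  interpret cof_vec_space n "TYPE(real)" .
  have v0: "v \<noteq> 0\<^sub>v n" using unit v by auto
  then have n: "n > 0" using v by (cases n) auto
  note bc = basis_completion[OF v v0]
  define ws where "ws = gram_schmidt n (basis_completion v)"
  note gs = gram_schmidt_result[OF bc(2,4,5) ws_def]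
  have len: "length ws = n" using gs(4) bc(6) by simp
  have carr: "ws ! i \<in> carrier_vec n" if "i < n" for i
    using gs(3) that len nth_mem by blast
  \<comment> \<open>The equivalence also excludes null vectors, so the division by norms below is
    legitimate.\<close>
  have orth: "(ws ! i \<bullet> ws ! j = 0) = (i \<noteq> j)" if "i < n" "j < n" for i j
    using corthogonalD[OF gs(2), of i j] that len by simp
  have "hd ws = v"
    unfolding ws_def basis_completion_def Let_def using v by simp
  then have ws0: "ws ! 0 = v" using len n hd_conv_nth[of ws] by auto
  define W where "W = mat_of_cols n (map (\<lambda>w. (1 / sqrt (w \<bullet> w)) \<cdot>\<^sub>v w) ws)"
  have W: "W \<in> carrier_mat n n" unfolding W_def using len by (simp add: carrier_matI)
  have colW: "col W i = (1 / sqrt (ws ! i \<bullet> ws ! i)) \<cdot>\<^sub>v (ws ! i)" if "i < n" for i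
    unfolding W_def using that carr[OF that] len by (subst col_mat_of_cols) auto
  have "W\<^sup>T * W = 1\<^sub>m n"
  proof (rule eq_matI)
    fix i j assume ij: "i < dim_row (1\<^sub>m n :: real mat)" "j < dim_col (1\<^sub>m n :: real mat)"
    have pos: "ws ! i \<bullet> ws ! i > 0"
      using orth[of i i] ij by (auto simp: order_less_le scalar_prod_def intro!: sum_nonneg)
    have "(W\<^sup>T * W) $$ (i, j) = col W i \<bullet> col W j" using ij W by simp
    also have "\<dots> = (ws ! i \<bullet> ws ! j) / (sqrt (ws ! i \<bullet> ws ! i) * sqrt (ws ! j \<bullet> ws ! j))"
      using ij carr[of i] carr[of j]
      by (simp add: colW scalar_prod_smult_distrib[of _ n] smult_scalar_prod_distrib[of _ n])
    also have "\<dots> = 1\<^sub>m n $$ (i, j)"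
      using ij orth[of i j] pos by auto
    finally show "(W\<^sup>T * W) $$ (i, j) = 1\<^sub>m n $$ (i, j)" .
  qed (use W in auto)
  moreover have "col W 0 = v" using colW[OF n] ws0 unit by simp
  ultimately show ?thesis using that W by blast
qed

lemma symmetric_conjugate:
  assumes "A \<in> carrier_mat n n" and "A\<^sup>T = (A :: real mat)" and "W \<in> carrier_mat n n"
  shows "(W\<^sup>T * A * W)\<^sup>T = W\<^sup>T * A * W"
  using assms by (simp add: transpose_mult[of _ n n _ n])

text \<open>In an orthonormal basis starting with the eigenvector \<open>v\<close>, the first column
  of the conjugated matrix is \<open>e\<close> followed by zeros, and by symmetry so is the first
  row. What remains is a symmetric block whose characteristic polynomial has lost exactly one
  factor. The free cofactor \<open>q\<close> covers both the base case, with \<open>q = 1\<close>,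
  and the inductive step below.\<close>

lemma symmetric_deflation:
  fixes A :: "real mat"
  assumes A: "A \<in> carrier_mat (Suc m) (Suc m)" and sym: "A\<^sup>T = A"
    and v: "v \<in> carrier_vec (Suc m)" and unit: "v \<bullet> v = 1"
    and ev: "A *\<^sub>v v = e \<cdot>\<^sub>v v"
    and cp: "char_poly A = [:- e, 1:] * q"
  obtains W B where "W \<in> carrier_mat (Suc m) (Suc m)" and "W\<^sup>T * W = 1\<^sub>m (Suc m)"
    and "col W 0 = v" and "B \<in> carrier_mat m m" and "B\<^sup>T = B" and "char_poly B = q"
    and "W\<^sup>T * A * W = four_block_mat (mat 1 1 (\<lambda>_. e)) (0\<^sub>m 1 m) (0\<^sub>m m 1) B"
proof -
  obtain W where W: "W \<in> carrier_mat (Suc m) (Suc m)" and orth: "W\<^sup>T * W = 1\<^sub>m (Suc m)"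
    and W0: "col W 0 = v" using orthonormal_completion[OF v unit] by blast
  define M where "M = W\<^sup>T * A * W"
  define B where "B = mat m m (\<lambda>(i, j). M $$ (Suc i, Suc j))"
  have M: "M \<in> carrier_mat (Suc m) (Suc m)" using A W by (simp add: M_def)
  have Msym: "M\<^sup>T = M" unfolding M_def using symmetric_conjugate[OF A sym W] .
  have swap: "M $$ (i, j) = M $$ (j, i)" if "i < Suc m" "j < Suc m" for i j
    using arg_cong[OF Msym, of "\<lambda>X. X $$ (j, i)"] M that by simp
  have M0: "M $$ (i, 0) = (if i = 0 then e else 0)" if i: "i < Suc m" for i
  proof -
    have "M $$ (i, 0) = (W\<^sup>T * (A * W)) $$ (i, 0)"
      using A W by (simp add: M_def)
    also have "\<dots> = col W i \<bullet> col (A * W) 0"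
      using i A W by simp
    also have "col (A * W) 0 = A *\<^sub>v col W 0"
      using A W by (intro col_mult2) auto
    also have "col W i \<bullet> \<dots> = col W i \<bullet> (e \<cdot>\<^sub>v col W 0)"
      by (simp add: W0 ev)
    also have "\<dots> = e * (col W i \<bullet> col W 0)"
      using i W by simp
    also have "col W i \<bullet> col W 0 = (W\<^sup>T * W) $$ (i, 0)" using i W by simp
    finally show ?thesis using i by (simp add: orth)
  qed
  have B: "B \<in> carrier_mat m m" by (simp add: B_def)
  have eq: "M = four_block_mat (mat 1 1 (\<lambda>_. e)) (0\<^sub>m 1 m) (0\<^sub>m m 1) B"
  proof (rule eq_matI)
    fix i j
    assume "i < dim_row (four_block_mat (mat 1 1 (\<lambda>_. e)) (0\<^sub>m 1 m) (0\<^sub>m m 1) B)"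
      and "j < dim_col (four_block_mat (mat 1 1 (\<lambda>_. e)) (0\<^sub>m 1 m) (0\<^sub>m m 1) B)"
    then have ij: "i < Suc m" "j < Suc m" using B by auto
    show "M $$ (i, j) = four_block_mat (mat 1 1 (\<lambda>_. e)) (0\<^sub>m 1 m) (0\<^sub>m m 1) B $$ (i, j)"
      using ij M0[of i] M0[of j] swap[of 0 j] B by (cases i; cases j) (auto simp: B_def)
  qed (use M B in auto)
  have "W * W\<^sup>T = 1\<^sub>m (Suc m)"
    using mat_mult_left_right_inverse[of "W\<^sup>T" "Suc m" W] W orth by simp
  then have "similar_mat M A"
    using A W M orth by (intro similar_matI[of _ _ "W\<^sup>T" W "Suc m"]) (auto simp: M_def)
  then have "char_poly M = [:- e, 1:] * q"
    using char_poly_similar cp by metis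
  moreover have "char_poly M = [:- e, 1:] * char_poly B"
    unfolding eq
    by (subst char_poly_four_block_zeros_col[OF _ _ B]) (auto simp: char_poly_defs det_single)
  ultimately have "char_poly B = q" by (simp del: mult_pCons_left)
  moreover have "B\<^sup>T = B"
    using swap by (intro eq_matI) (auto simp: B_def)
  ultimately show ?thesis using that W orth W0 B eq unfolding M_def by blast
qed

lemma eigenvalue_unit_eigenvector:
  fixes A :: "real mat"
  assumes A: "A \<in> carrier_mat n n" and "eigenvalue A e"
  obtains v where "v \<in> carrier_vec n" and "v \<bullet> v = 1" and "A *\<^sub>v v = e \<cdot>\<^sub>v v"
proof -
  obtain w where w: "w \<in> carrier_vec n" "w \<noteq> 0\<^sub>v n" "A *\<^sub>v w = e \<cdot>\<^sub>v w"
    using assms unfolding eigenvalue_def eigenvector_def by auto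
  have pos: "w \<bullet> w > 0"
    using conjugate_square_greater_0_vec[OF w(1)] w(2) by simp
  let ?c = "1 / sqrt (w \<bullet> w)"
  have "(?c \<cdot>\<^sub>v w) \<bullet> (?c \<cdot>\<^sub>v w) = 1" using w pos by simp
  moreover have "A *\<^sub>v (?c \<cdot>\<^sub>v w) = e \<cdot>\<^sub>v (?c \<cdot>\<^sub>v w)"
    using A w by (simp add: mult_mat_vec smult_smult_assoc mult.commute)
  ultimately show ?thesis using that[of "?c \<cdot>\<^sub>v w"] w by simp
qed

text \<open>Induction by deflation. Both the order of the eigenvalues on the diagonal and the first
  basis vector are prescribed, so that the Perron vector can open the eigenbasis; for the later
  eigenvalues any unit eigenvector of the remaining block will do.\<close>

lemma real_symmetric_spectral:
  fixes A :: "real mat"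
  assumes "A \<in> carrier_mat n n" and "A\<^sup>T = A"
    and "char_poly A = (\<Prod>e\<leftarrow>e # es. [:- e, 1:])"
    and "v \<in> carrier_vec n" and "v \<bullet> v = 1" and "A *\<^sub>v v = e \<cdot>\<^sub>v v"
  shows "\<exists>P. P \<in> carrier_mat n n \<and> P\<^sup>T * P = 1\<^sub>m n \<and> col P 0 = v
    \<and> P\<^sup>T * A * P = mat_diag n (\<lambda>i. (e # es) ! i)"
  using assms
proof (induction es arbitrary: n A e v)
  case Nil
  have "n = 1" using degree_monic_char_poly[OF Nil.prems(1)] Nil.prems(3) by simp
  obtain W B where W: "W \<in> carrier_mat 1 1" "W\<^sup>T * W = 1\<^sub>m 1" "col W 0 = v"
    and B: "B \<in> carrier_mat 0 0"
    and eq: "W\<^sup>T * A * W = four_block_mat (mat 1 1 (\<lambda>_. e)) (0\<^sub>m 1 0) (0\<^sub>m 0 1) B"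
  proof (rule symmetric_deflation[of A 0 v e 1])
    show "A \<in> carrier_mat (Suc 0) (Suc 0)" "v \<in> carrier_vec (Suc 0)"
      using Nil.prems \<open>n = 1\<close> by auto
    show "char_poly A = [:- e, 1:] * 1" using Nil.prems(3) by simp
  qed (use Nil.prems in auto)
  have "W\<^sup>T * A * W = mat_diag 1 (\<lambda>i. [e] ! i)"
    unfolding eq using B by (intro eq_matI) (auto simp: mat_diag_def)
  then show ?case using W \<open>n = 1\<close> by blast
next
  case (Cons e' es)
  define m where "m = n - 1"
  have "n = degree (char_poly A)" using degree_monic_char_poly[OF Cons.prems(1)] by simp
  also have "\<dots> = Suc (Suc (length es))"
    unfolding Cons.prems(3) using degree_linear_factors[of uminus "e # e' # es"] by simp
  finally have n: "n = Suc m" by (simp add: m_def)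
  define q where "q = (\<Prod>e\<leftarrow>e' # es. [:- e, 1:])"
  have A: "A \<in> carrier_mat (Suc m) (Suc m)" "v \<in> carrier_vec (Suc m)"
    using Cons.prems n by auto
  have "char_poly A = [:- e, 1:] * q" using Cons.prems(3) by (simp add: q_def)
  then obtain W B where W: "W \<in> carrier_mat (Suc m) (Suc m)" "W\<^sup>T * W = 1\<^sub>m (Suc m)" "col W 0 = v"
    and B: "B \<in> carrier_mat m m" "B\<^sup>T = B" "char_poly B = q"
    and eq: "W\<^sup>T * A * W = four_block_mat (mat 1 1 (\<lambda>_. e)) (0\<^sub>m 1 m) (0\<^sub>m m 1) B"
    using symmetric_deflation[OF A(1) Cons.prems(2) A(2) Cons.prems(5,6)] by metis
  have "eigenvalue B e'"
    unfolding eigenvalue_root_char_poly[OF B(1)] B(3) q_def by simp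
  from eigenvalue_unit_eigenvector[OF B(1) this] obtain w where
    "w \<in> carrier_vec m" "w \<bullet> w = 1" "B *\<^sub>v w = e' \<cdot>\<^sub>v w" .
  from Cons.IH[OF B(1,2) B(3)[unfolded q_def] this] obtain R where
    R: "R \<in> carrier_mat m m" "R\<^sup>T * R = 1\<^sub>m m" "R\<^sup>T * B * R = mat_diag m (\<lambda>i. (e' # es) ! i)"
    by blast
  \<comment> \<open>\<open>R\<close> diagonalizes the block on the orthogonal complement of
    \<open>v\<close>. Bordering it with a 1 fixes the first coordinate, so \<open>W * Q\<close>
    still has first column \<open>v\<close>.\<close>
  define Q where "Q = four_block_mat (1\<^sub>m 1) (0\<^sub>m 1 m) (0\<^sub>m m 1) R"
  have QT: "Q\<^sup>T = four_block_mat (1\<^sub>m 1) (0\<^sub>m 1 m) (0\<^sub>m m 1) R\<^sup>T"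
    unfolding Q_def using R by (subst transpose_four_block_mat) auto
  have Q: "Q \<in> carrier_mat (Suc m) (Suc m)" unfolding Q_def using R(1) by auto
  have QQ: "Q\<^sup>T * Q = 1\<^sub>m (Suc m)"
    unfolding QT unfolding Q_def using R(1,2)
    by (subst mult_four_block_mat[of _ 1 1 _ m _ m _ _ 1 _ m]) (auto intro!: eq_matI)
  have QMQ: "Q\<^sup>T * (W\<^sup>T * A * W) * Q
      = four_block_mat (mat 1 1 (\<lambda>_. e)) (0\<^sub>m 1 m) (0\<^sub>m m 1) (R\<^sup>T * B * R)"
    unfolding QT eq unfolding Q_def using R(1) B(1)
    by (subst mult_four_block_mat[of _ 1 1 _ m _ m _ _ 1 _ m]; simp?)+
  also have "\<dots> = mat_diag n (\<lambda>i. (e # e' # es) ! i)"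
    unfolding R(3) n by (intro eq_matI) (auto simp: mat_diag_def nth_Cons')
  finally have D: "Q\<^sup>T * (W\<^sup>T * A * W) * Q = mat_diag n (\<lambda>i. (e # e' # es) ! i)" .
  let ?P = "W * Q"
  have PT: "?P\<^sup>T = Q\<^sup>T * W\<^sup>T" using W(1) Q by (rule transpose_mult)
  note assoc = assoc_mult_mat[of _ "Suc m" "Suc m" _ "Suc m" _ "Suc m"]
  have "?P\<^sup>T * ?P = Q\<^sup>T * ((W\<^sup>T * W) * Q)"
    unfolding PT using W(1) Q by (simp add: assoc del: assoc_mult_mat)
  also have "\<dots> = 1\<^sub>m n" using QQ Q n by (simp add: W(2))
  finally have "?P\<^sup>T * ?P = 1\<^sub>m n" .
  moreover have "?P\<^sup>T * A * ?P = mat_diag n (\<lambda>i. (e # e' # es) ! i)"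
    unfolding PT D[symmetric] using W(1) Q A(1) by (simp add: assoc)
  moreover have "col Q 0 = unit_vec (Suc m) 0"
    unfolding Q_def using R(1) by (intro eq_vecI) auto
  then have "col ?P 0 = v"
    using W(1,3) Q by (subst col_mult2[of _ "Suc m" "Suc m" _ "Suc m"]) auto
  ultimately show ?case using W(1) Q n by (intro exI[of _ ?P]) auto
qed

section \<open>Bilinear forms in an eigenbasis and expander mixing\<close>

lemma mat_diag_mult_vec:
  fixes z :: "'a::semiring_0 vec"
  assumes "z \<in> carrier_vec n"
  shows "mat_diag n f *\<^sub>v z = vec n (\<lambda>i. f i * z $ i)"
proof (rule eq_vecI)
  fix i assume i: "i < dim_vec (vec n (\<lambda>i. f i * z $ i))"
  have "(mat_diag n f *\<^sub>v z) $ i = (\<Sum>j\<in>{0..<n}. (if i = j then f j else 0) * z $ j)"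
    using assms i by (simp add: mat_diag_def scalar_prod_def)
  also have "\<dots> = (\<Sum>j\<in>{0..<n}. if j = i then f i * z $ i else 0)"
    by (intro sum.cong) auto
  finally show "(mat_diag n f *\<^sub>v z) $ i = vec n (\<lambda>i. f i * z $ i) $ i" using i by simp
qed (simp add: mat_diag_def)

lemma eigvals_antimono:
  assumes "A \<in> carrier_mat n n" and "A\<^sup>T = A" and "i \<le> j" and "j < n"
  shows "eigvals A ! j \<le> eigvals A ! i"
proof (cases "i = j")
  case False
  then show ?thesis
    using sorted_wrt_nth_less[OF eigvals_char_poly(3)[OF assms(1,2)], of i j] assms
    by (simp add: eigvals_char_poly(2))
qed simp

text \<open>\<open>Q\<close> is the transpose of an orthogonal matrix of eigenvectors, so
  \<open>Q *\<^sub>v x\<close> holds the coordinates of \<open>x\<close> in an eigenbasis that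
  begins with \<open>v\<close>. The inner product is then Parseval's identity, and the form of
  \<open>A\<close> becomes diagonal.\<close>

lemma symmetric_bilinear_diagonal:
  fixes A :: "real mat"
  assumes A: "A \<in> carrier_mat n n" and sym: "A\<^sup>T = A" and "n > 0"
    and v: "v \<in> carrier_vec n" "v \<bullet> v = 1" "A *\<^sub>v v = eigvals A ! 0 \<cdot>\<^sub>v v"
  shows "\<exists>Q. (\<forall>x. (Q *\<^sub>v x) $ 0 = v \<bullet> x) \<and> (\<forall>x\<in>carrier_vec n. \<forall>y\<in>carrier_vec n.
      x \<bullet> y = (\<Sum>i<n. (Q *\<^sub>v x) $ i * (Q *\<^sub>v y) $ i)
      \<and> x \<bullet> (A *\<^sub>v y) = (\<Sum>i<n. eigvals A ! i * ((Q *\<^sub>v x) $ i * (Q *\<^sub>v y) $ i)))"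
proof -
  let ?D = "mat_diag n (\<lambda>i. eigvals A ! i)"
  obtain e es where es: "eigvals A = e # es"
    using eigvals_char_poly(2)[OF A sym] \<open>n > 0\<close> by (cases "eigvals A") auto
  obtain P where P: "P \<in> carrier_mat n n" "P\<^sup>T * P = 1\<^sub>m n" "col P 0 = v" "P\<^sup>T * A * P = ?D"
    using real_symmetric_spectral[OF A sym _ v(1,2), of e es] eigvals_char_poly(1)[OF A sym] v(3)
    unfolding es by auto
  have PT: "P\<^sup>T \<in> carrier_mat n n" using P by simp
  have PP: "P * P\<^sup>T = 1\<^sub>m n"
    using mat_mult_left_right_inverse[OF PT P(1,2)] .
  have D: "?D \<in> carrier_mat n n" by simp
  have "P * ?D * P\<^sup>T = (P * P\<^sup>T) * A * (P * P\<^sup>T)"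
    unfolding P(4)[symmetric] using A P(1)
    by (simp add: assoc_mult_mat[of _ n n _ n _ n])
  then have AP: "A = P * ?D * P\<^sup>T" using A by (simp add: PP)
  define T where "T x = P\<^sup>T *\<^sub>v x" for x
  have T: "T x \<in> carrier_vec n" if "x \<in> carrier_vec n" for x
    using PT that by (simp add: T_def)
  have adj: "x \<bullet> (P *\<^sub>v z) = T x \<bullet> z" if "x \<in> carrier_vec n" "z \<in> carrier_vec n" for x z
    using transpose_vec_mult_scalar[OF P(1) that(2,1)] unfolding T_def ..
  show ?thesis
  proof (rule exI[of _ "P\<^sup>T"], unfold T_def[symmetric], intro conjI allI ballI)
    show "T x $ 0 = v \<bullet> x" for x
      using P(1,3) \<open>n > 0\<close> by (simp add: T_def)
  next
    fix x y :: "real vec" assume xy: "x \<in> carrier_vec n" "y \<in> carrier_vec n"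
    have "y = P *\<^sub>v (T y)"
      using xy P(1) PT by (simp add: T_def PP flip: assoc_mult_mat_vec)
    then have "x \<bullet> y = T x \<bullet> T y" using adj[OF xy(1) T[OF xy(2)]] by simp
    then show "x \<bullet> y = (\<Sum>i<n. T x $ i * T y $ i)"
      using T[OF xy(2)] by (simp add: scalar_prod_def atLeast0LessThan)
    have "A *\<^sub>v y = P *\<^sub>v (?D *\<^sub>v T y)"
      using P(1) PT xy by (subst AP) (simp add: T_def assoc_mult_mat_vec[of _ n n _ n])
    then have "x \<bullet> (A *\<^sub>v y) = T x \<bullet> (?D *\<^sub>v T y)"
      using adj[OF xy(1), of "?D *\<^sub>v T y"] T[OF xy(2)] mult_mat_vec_carrier[OF D] by simp
    also have "\<dots> = (\<Sum>i<n. T x $ i * (eigvals A ! i * T y $ i))"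
      by (simp add: mat_diag_mult_vec[OF T[OF xy(2)]] scalar_prod_def atLeast0LessThan)
    finally show "x \<bullet> (A *\<^sub>v y) = (\<Sum>i<n. eigvals A ! i * (T x $ i * T y $ i))"
      by (simp add: mult.left_commute)
  qed
qed

text \<open>Orthogonality to \<open>v\<close> kills coordinate 0. Every other eigenvalue lies
  between the second and the last one, so its absolute value is at most the maximum of theirs;
  Cauchy-Schwarz bounds the remaining sum.\<close>

lemma symmetric_bilinear_bound:
  fixes A :: "real mat"
  assumes A: "A \<in> carrier_mat n n" and sym: "A\<^sup>T = A" and n: "n \<ge> 2"
    and v: "v \<in> carrier_vec n" "v \<bullet> v = 1" "A *\<^sub>v v = eigvals A ! 0 \<cdot>\<^sub>v v"
    and x: "x \<in> carrier_vec n" "v \<bullet> x = 0" and y: "y \<in> carrier_vec n" "v \<bullet> y = 0"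
  shows "\<bar>x \<bullet> (A *\<^sub>v y)\<bar>
    \<le> max \<bar>eigvals A ! 1\<bar> \<bar>eigvals A ! (n - 1)\<bar> * (sqrt (x \<bullet> x) * sqrt (y \<bullet> y))"
proof -
  let ?\<mu> = "max \<bar>eigvals A ! 1\<bar> \<bar>eigvals A ! (n - 1)\<bar>"
  have "n > 0" using n by simp
  from symmetric_bilinear_diagonal[OF A sym this v] obtain Q where
    Q: "(\<forall>x. (Q *\<^sub>v x) $ 0 = v \<bullet> x) \<and> (\<forall>x\<in>carrier_vec n. \<forall>y\<in>carrier_vec n.
      x \<bullet> y = (\<Sum>i<n. (Q *\<^sub>v x) $ i * (Q *\<^sub>v y) $ i)
      \<and> x \<bullet> (A *\<^sub>v y) = (\<Sum>i<n. eigvals A ! i * ((Q *\<^sub>v x) $ i * (Q *\<^sub>v y) $ i)))"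
    by (rule exE)
  then have T0: "\<And>x. (Q *\<^sub>v x) $ 0 = v \<bullet> x"
    and T: "\<And>x y. x \<in> carrier_vec n \<Longrightarrow> y \<in> carrier_vec n
      \<Longrightarrow> x \<bullet> y = (\<Sum>i<n. (Q *\<^sub>v x) $ i * (Q *\<^sub>v y) $ i)"
    and TA: "\<And>x y. x \<in> carrier_vec n \<Longrightarrow> y \<in> carrier_vec n
      \<Longrightarrow> x \<bullet> (A *\<^sub>v y) = (\<Sum>i<n. eigvals A ! i * ((Q *\<^sub>v x) $ i * (Q *\<^sub>v y) $ i))"
    by auto
  have eig: "\<bar>eigvals A ! i\<bar> \<le> ?\<mu>" if "i \<noteq> 0" "i < n" for i
    using eigvals_antimono[OF A sym, of 1 i] eigvals_antimono[OF A sym, of i "n - 1"] that n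
    by linarith
  have "\<bar>x \<bullet> (A *\<^sub>v y)\<bar> \<le> (\<Sum>i<n. \<bar>eigvals A ! i * ((Q *\<^sub>v x) $ i * (Q *\<^sub>v y) $ i)\<bar>)"
    unfolding TA[OF x(1) y(1)] by (rule sum_abs)
  also have "\<dots> \<le> (\<Sum>i<n. ?\<mu> * (\<bar>(Q *\<^sub>v x) $ i\<bar> * \<bar>(Q *\<^sub>v y) $ i\<bar>))"
  proof (rule sum_mono)
    fix i assume "i \<in> {..<n}"
    then show "\<bar>eigvals A ! i * ((Q *\<^sub>v x) $ i * (Q *\<^sub>v y) $ i)\<bar>
        \<le> ?\<mu> * (\<bar>(Q *\<^sub>v x) $ i\<bar> * \<bar>(Q *\<^sub>v y) $ i\<bar>)"
      using eig[of i] T0 x(2) by (cases "i = 0") (auto simp: abs_mult intro!: mult_right_mono)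
  qed
  also have "\<dots> = ?\<mu> * (\<Sum>i<n. \<bar>(Q *\<^sub>v x) $ i\<bar> * \<bar>(Q *\<^sub>v y) $ i\<bar>)"
    by (simp add: sum_distrib_left)
  also have "\<dots> \<le> ?\<mu> * (sqrt (x \<bullet> x) * sqrt (y \<bullet> y))"
  proof (rule mult_left_mono)
    show "(\<Sum>i<n. \<bar>(Q *\<^sub>v x) $ i\<bar> * \<bar>(Q *\<^sub>v y) $ i\<bar>) \<le> sqrt (x \<bullet> x) * sqrt (y \<bullet> y)"
      using L2_set_mult_ineq[of "($) (Q *\<^sub>v x)" "($) (Q *\<^sub>v y)" "{..<n}"]
      by (simp add: L2_set_def T[OF x(1) x(1)] T[OF y(1) y(1)] power2_eq_square)
  qed simp
  finally show ?thesis .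
qed

text \<open>In an eigenbasis the quadratic form is a sum of squares whose coefficients are all at
  least the last entry of the decreasing list. The basis may start with any unit eigenvector for the
  largest eigenvalue.\<close>

lemma rayleigh_ge_least_eigval:
  fixes A :: "real mat"
  assumes A: "A \<in> carrier_mat n n" and sym: "A\<^sup>T = A" and "n > 0"
    and x: "x \<in> carrier_vec n"
  shows "eigvals A ! (n - 1) * (x \<bullet> x) \<le> x \<bullet> (A *\<^sub>v x)"
proof -
  have "eigvals A ! 0 \<in> set (eigvals A)"
    using eigvals_char_poly(2)[OF A sym] \<open>n > 0\<close> by simp
  then have "eigenvalue A (eigvals A ! 0)" by (simp add: eigvals_char_poly(4)[OF A sym])
  from eigenvalue_unit_eigenvector[OF A this] obtain v where
    v: "v \<in> carrier_vec n" "v \<bullet> v = 1" "A *\<^sub>v v = eigvals A ! 0 \<cdot>\<^sub>v v" .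
  from symmetric_bilinear_diagonal[OF A sym \<open>n > 0\<close> v] obtain Q where
    Q: "(\<forall>x. (Q *\<^sub>v x) $ 0 = v \<bullet> x) \<and> (\<forall>x\<in>carrier_vec n. \<forall>y\<in>carrier_vec n.
      x \<bullet> y = (\<Sum>i<n. (Q *\<^sub>v x) $ i * (Q *\<^sub>v y) $ i)
      \<and> x \<bullet> (A *\<^sub>v y) = (\<Sum>i<n. eigvals A ! i * ((Q *\<^sub>v x) $ i * (Q *\<^sub>v y) $ i)))"
    by (rule exE)
  then have T: "x \<bullet> x = (\<Sum>i<n. (Q *\<^sub>v x) $ i * (Q *\<^sub>v x) $ i)"
    and TA: "x \<bullet> (A *\<^sub>v x) = (\<Sum>i<n. eigvals A ! i * ((Q *\<^sub>v x) $ i * (Q *\<^sub>v x) $ i))"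
    using x by auto
  show ?thesis unfolding T TA sum_distrib_left
    using eigvals_antimono[OF A sym] by (intro sum_mono mult_right_mono) auto
qed

text \<open>The weighted vectors \<open>f c\<close> and \<open>f d\<close> are projected away from
  \<open>v\<close>, and the bilinear bound is applied to the projections. Hypothesis
  \<open>le\<close> tolerates a contribution measured by the losses \<open>c i * (1 - c i)\<close>,
  which vanish for 0/1 weights. These losses are exactly what the squared norms lack, so the two
  error terms recombine without cost.\<close>

lemma weighted_expander_mixing:
  fixes A :: "real mat" and c d :: "nat \<Rightarrow> real" and n :: nat
  defines "\<mu> \<equiv> max \<bar>eigvals A ! 1\<bar> \<bar>eigvals A ! (n - 1)\<bar>"
  assumes A: "A \<in> carrier_mat n n" and sym: "A\<^sup>T = A" and n: "n \<ge> 2"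
    and v: "v \<in> carrier_vec n" "v \<bullet> v = 1" "A *\<^sub>v v = eigvals A ! 0 \<cdot>\<^sub>v v"
    and c: "\<And>i. i < n \<Longrightarrow> c i \<in> {0..1}" and d: "\<And>i. i < n \<Longrightarrow> d i \<in> {0..1}"
    and le: "(\<Sum>i<n. \<Sum>j<n. c i * v $ i * (A $$ (i, j) * (d j * v $ j)))
      \<le> \<mu> * (sqrt (\<Sum>i<n. c i * (1 - c i) * (v $ i)\<^sup>2) * sqrt (\<Sum>i<n. d i * (1 - d i) * (v $ i)\<^sup>2))"
  shows "eigvals A ! 0 * sqrt ((\<Sum>i<n. c i * (v $ i)\<^sup>2) * (\<Sum>i<n. d i * (v $ i)\<^sup>2))
    \<le> \<mu> * sqrt ((1 - (\<Sum>i<n. c i * (v $ i)\<^sup>2)) * (1 - (\<Sum>i<n. d i * (v $ i)\<^sup>2)))"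
proof -
  define l where "l = eigvals A ! 0"
  have m0: "\<mu> \<ge> 0" by (simp add: \<mu>_def)
  have vv: "(\<Sum>i<n. (v $ i)\<^sup>2) = 1"
    using v(1,2) by (simp add: scalar_prod_def atLeast0LessThan power2_eq_square)
  define w where "w c = (\<Sum>i<n. c i * (v $ i)\<^sup>2)" for c :: "nat \<Rightarrow> real"
  define h where "h c = (\<Sum>i<n. c i * (1 - c i) * (v $ i)\<^sup>2)" for c :: "nat \<Rightarrow> real"
  define f where "f c = vec n (\<lambda>i. c i * v $ i)" for c :: "nat \<Rightarrow> real"
  define p where "p c = f c - w c \<cdot>\<^sub>v v" for c
  have f: "f c \<in> carrier_vec n" "p c \<in> carrier_vec n" for c
    using v(1) by (auto simp: f_def p_def)
  have vf: "v \<bullet> f c = w c" for c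
    using v(1) by (simp add: f_def w_def scalar_prod_def atLeast0LessThan power2_eq_square ac_simps)
  \<comment> \<open>From \<open>c i * c i = c i - c i * (1 - c i)\<close>: fractional weights
    shorten \<open>f c\<close> by the loss \<open>h c\<close>.\<close>
  have ff: "f c \<bullet> f c = w c - h c" for c
    by (simp add: f_def w_def h_def scalar_prod_def atLeast0LessThan power2_eq_square
        algebra_simps flip: sum_subtractf)
  have vp: "v \<bullet> p c = 0" for c
    using v(1,2) f by (simp add: p_def scalar_prod_minus_distrib[of _ n] vf)
  have fp: "x \<bullet> p c = x \<bullet> f c - w c * (x \<bullet> v)" if "x \<in> carrier_vec n" for x c
    using that v(1) f by (simp add: p_def scalar_prod_minus_distrib[of _ n])
  have pf: "p c \<bullet> x = f c \<bullet> x - w c * (v \<bullet> x)" if "x \<in> carrier_vec n" for x c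
    using that v(1) f by (simp add: p_def minus_scalar_prod_distrib[of _ n])
  have pp: "p c \<bullet> p c = w c - h c - (w c)\<^sup>2" for c
    using fp[OF f(2), of c c] pf[OF f(1), of c c] vp[of c] comm_scalar_prod[OF f(2) v(1)]
    by (simp add: vf ff power2_eq_square)
  have vA: "v \<bullet> (A *\<^sub>v x) = l * (v \<bullet> x)" if "x \<in> carrier_vec n" for x
    using transpose_vec_mult_scalar[OF A that v(1)] v that by (simp add: sym l_def)
  \<comment> \<open>Since \<open>v\<close> is an eigenvector of the symmetric matrix
    \<open>A\<close>, removing the components along \<open>v\<close> changes the form only by
    \<open>l\<close> times the product of the two masses.\<close>
  have Ap: "p c \<bullet> (A *\<^sub>v p d) = f c \<bullet> (A *\<^sub>v f d) - l * (w c * w d)" for c d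
  proof -
    have "p c \<bullet> (A *\<^sub>v p d) = f c \<bullet> (A *\<^sub>v p d)"
      using pf[of "A *\<^sub>v p d" c] vA[OF f(2)[of d]] A f(2) vp by simp
    also have "\<dots> = (A *\<^sub>v f c) \<bullet> p d"
      using transpose_vec_mult_scalar[OF A f(2)[of d] f(1)[of c]] by (simp add: sym)
    also have "\<dots> = (A *\<^sub>v f c) \<bullet> f d - w d * (v \<bullet> (A *\<^sub>v f c))"
      using fp[of "A *\<^sub>v f c" d] A f(1) comm_scalar_prod[of "A *\<^sub>v f c" n v] v(1) by simp
    also have "(A *\<^sub>v f c) \<bullet> f d = f c \<bullet> (A *\<^sub>v f d)"
      using transpose_vec_mult_scalar[OF A f(1)[of d] f(1)[of c]] by (simp add: sym)
    finally show ?thesis using vA[OF f(1)[of c]] vf[of c] by simp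
  qed
  have range: "h c \<ge> 0" "w c \<ge> 0" "w c \<le> 1" if "\<And>i. i < n \<Longrightarrow> c i \<in> {0..1}" for c
  proof -
    show "h c \<ge> 0" "w c \<ge> 0" using that by (auto simp: h_def w_def intro!: sum_nonneg)
    have "w c \<le> (\<Sum>i<n. (v $ i)\<^sup>2)"
      unfolding w_def using that by (intro sum_mono mult_left_le_one_le) auto
    then show "w c \<le> 1" by (simp add: vv)
  qed
  have sq: "p c \<bullet> p c \<ge> 0" for c
    using f(2)[of c] by (auto simp: scalar_prod_def intro!: sum_nonneg)
  define a b where "a = w c" and "b = w d"
  note rc = range[of c, OF c] and rd = range[of d, OF d]
  have "f c \<bullet> (A *\<^sub>v f d) = (\<Sum>i<n. \<Sum>j<n. c i * v $ i * (A $$ (i, j) * (d j * v $ j)))"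
    using A by (simp add: f_def scalar_prod_def atLeast0LessThan sum_distrib_left)
  with le have "f c \<bullet> (A *\<^sub>v f d) \<le> \<mu> * (sqrt (h c) * sqrt (h d))"
    by (simp add: h_def)
  moreover have "- (p c \<bullet> (A *\<^sub>v p d)) \<le> \<mu> * (sqrt (p c \<bullet> p c) * sqrt (p d \<bullet> p d))"
    using symmetric_bilinear_bound[OF A sym n v f(2) vp f(2) vp, of c d]
    unfolding \<mu>_def by linarith
  ultimately have "l * (a * b) \<le> \<mu> * (sqrt (h c) * sqrt (h d) + sqrt (p c \<bullet> p c) * sqrt (p d \<bullet> p d))"
    by (simp add: Ap a_def b_def distrib_left)
  also have "\<dots> \<le> \<mu> * (sqrt (h c + p c \<bullet> p c) * sqrt (h d + p d \<bullet> p d))"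
  proof (rule mult_left_mono[OF _ m0])
    \<comment> \<open>Lagrange's identity, that is, Cauchy-Schwarz in the plane for the vectors with
      coordinates \<open>sqrt (h c)\<close>, \<open>sqrt (p c \<bullet> p c)\<close> and likewise
      for \<open>d\<close>.\<close>
    have "(h c + p c \<bullet> p c) * (h d + p d \<bullet> p d) - (sqrt (h c) * sqrt (h d) + sqrt (p c \<bullet> p c) * sqrt (p d \<bullet> p d))\<^sup>2
      = (sqrt (h c) * sqrt (p d \<bullet> p d) - sqrt (h d) * sqrt (p c \<bullet> p c))\<^sup>2"
      using rc(1) rd(1) sq[of c] sq[of d]
      by (simp add: power2_eq_square algebra_simps) (simp add: mult.assoc[symmetric])
    then have "(sqrt (h c) * sqrt (h d) + sqrt (p c \<bullet> p c) * sqrt (p d \<bullet> p d))\<^sup>2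
      \<le> (h c + p c \<bullet> p c) * (h d + p d \<bullet> p d)"
      by (metis diff_ge_0_iff_ge zero_le_power2)
    then show "sqrt (h c) * sqrt (h d) + sqrt (p c \<bullet> p c) * sqrt (p d \<bullet> p d)
      \<le> sqrt (h c + p c \<bullet> p c) * sqrt (h d + p d \<bullet> p d)"
      by (metis real_le_rsqrt real_sqrt_mult)
  qed
  \<comment> \<open>The loss cancels: \<open>h c + p c \<bullet> p c\<close> equals
    \<open>w c * (1 - w c)\<close>.\<close>
  also have "\<dots> = \<mu> * (sqrt (a * b) * sqrt ((1 - a) * (1 - b)))"
    by (simp add: pp a_def b_def power2_eq_square algebra_simps flip: real_sqrt_mult)
  finally have *: "l * (a * b) \<le> \<mu> * (sqrt (a * b) * sqrt ((1 - a) * (1 - b)))" .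
  have "a * b \<ge> 0" "(1 - a) * (1 - b) \<ge> 0" using rc rd by (auto simp: a_def b_def)
  have "l * sqrt (a * b) \<le> \<mu> * sqrt ((1 - a) * (1 - b))"
  proof (cases "a * b = 0")
    case True
    show ?thesis unfolding True using m0 \<open>(1 - a) * (1 - b) \<ge> 0\<close> by simp
  next
    case False
    then have pos: "sqrt (a * b) > 0" using \<open>a * b \<ge> 0\<close> by (metis less_le real_sqrt_gt_0_iff)
    have "sqrt (a * b) * (l * sqrt (a * b)) \<le> sqrt (a * b) * (\<mu> * sqrt ((1 - a) * (1 - b)))"
      using * \<open>a * b \<ge> 0\<close> by (simp add: mult.left_commute)
    then show ?thesis using pos by (simp only: mult_le_cancel_left_pos)
  qed
  then show ?thesis by (simp add: l_def a_def b_def w_def)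
qed

text \<open>Test the Rayleigh bound on the difference of two unit vectors: with zero diagonal
  entries its form is \<open>- 2 * M $$ (p, q)\<close> and its squared norm is 2. This controls the
  single surviving edge in the odd case.\<close>

lemma entry_le_abs_least_eigval:
  fixes M :: "real mat"
  assumes M: "M \<in> carrier_mat n n" and sym: "M\<^sup>T = M"
    and p: "p < n" and q: "q < n" and "p \<noteq> q" and diag: "M $$ (p, p) = 0" "M $$ (q, q) = 0"
  shows "M $$ (p, q) \<le> \<bar>eigvals M ! (n - 1)\<bar>"
proof -
  define x :: "real vec" where "x = unit_vec n p - unit_vec n q"
  have x: "x \<in> carrier_vec n" by (simp add: x_def)
  have row: "(M *\<^sub>v x) $ i = M $$ (i, p) - M $$ (i, q)" if "i < n" for i
    using M that p q by (simp add: x_def scalar_prod_minus_distrib[of _ n])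
  have dot: "x \<bullet> y = y $ p - y $ q" if "y \<in> carrier_vec n" for y
    using that p q by (simp add: x_def minus_scalar_prod_distrib[of _ n])
  have "M $$ (q, p) = M $$ (p, q)"
    using arg_cong[OF sym, of "\<lambda>X. X $$ (p, q)"] M p q by simp
  then have xMx: "x \<bullet> (M *\<^sub>v x) = - 2 * M $$ (p, q)"
    using dot[OF mult_mat_vec_carrier[OF M x]] row[OF p] row[OF q] by (simp add: diag)
  have xx: "x \<bullet> x = 2"
    using dot[OF x] p q \<open>p \<noteq> q\<close> by (simp add: x_def)
  have "n > 0" using p by simp
  from rayleigh_ge_least_eigval[OF M sym this x]
  have "eigvals M ! (n - 1) * 2 \<le> - 2 * M $$ (p, q)" by (simp only: xMx xx)
  then show ?thesis by linarith
qed

text \<open>After squaring this is the arithmetic-geometric mean inequality. It serves the second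
  bound, which estimates the masses from below only.\<close>

lemma sqrt_mult_complement_le:
  fixes a b :: real
  assumes "a \<in> {0..1}" and "b \<in> {0..1}"
  shows "sqrt ((1 - a) * (1 - b)) \<le> 1 - sqrt (a * b)"
proof (rule real_le_lsqrt)
  have "sqrt (a * b) \<le> (a + b) / 2" using assms by (intro arith_geo_mean_sqrt) auto
  then show "(1 - a) * (1 - b) \<le> (1 - sqrt (a * b))\<^sup>2"
    using assms by (simp add: power2_eq_square algebra_simps flip: real_sqrt_mult)
  show "0 \<le> 1 - sqrt (a * b)" using assms by (simp add: mult_le_one)
qed

text \<open>Take an eigenvector \<open>x\<close> for \<open>e\<close> and an index where
  \<open>\<bar>x $ j\<bar> / u $ j\<close> is largest. The eigenvalue equation there, estimated with
  nonnegative entries, gives \<open>\<bar>e\<bar> \<le> \<theta>\<close>. This identifies the top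
  eigenvalue of the normalized adjacency matrix from its explicit eigenvector.\<close>

lemma eigvals_hd_of_positive_eigenvector:
  fixes M :: "real mat"
  assumes M: "M \<in> carrier_mat n n" and sym: "M\<^sup>T = M" and n: "n > 0"
    and nonneg: "\<And>i j. i < n \<Longrightarrow> j < n \<Longrightarrow> M $$ (i, j) \<ge> 0"
    and u: "u \<in> carrier_vec n" "\<And>i. i < n \<Longrightarrow> u $ i > 0" and ev: "M *\<^sub>v u = \<theta> \<cdot>\<^sub>v u"
  shows "eigvals M ! 0 = \<theta>"
proof -
  have mult: "(M *\<^sub>v x) $ i = (\<Sum>j<n. M $$ (i, j) * x $ j)" if "i < n" "x \<in> carrier_vec n" for i x
    using M that by (simp add: scalar_prod_def atLeast0LessThan)
  have le: "e \<le> \<theta>" if e: "eigenvalue M e" for e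
  proof -
    obtain x where x: "x \<in> carrier_vec n" "x \<noteq> 0\<^sub>v n" "M *\<^sub>v x = e \<cdot>\<^sub>v x"
      using e M unfolding eigenvalue_def eigenvector_def by auto
    define r where "r = Max ((\<lambda>j. \<bar>x $ j\<bar> / u $ j) ` {..<n})"
    have "r \<in> (\<lambda>j. \<bar>x $ j\<bar> / u $ j) ` {..<n}" unfolding r_def using n by (intro Max_in) auto
    then obtain i where i: "i < n" "r = \<bar>x $ i\<bar> / u $ i" by auto
    have le_r: "\<bar>x $ j\<bar> / u $ j \<le> r" if "j < n" for j
      unfolding r_def using that by (intro Max_ge) auto
    have r: "\<bar>x $ j\<bar> \<le> u $ j * r" if "j < n" for j
      using le_r[OF that] u(2)[OF that] by (simp add: pos_divide_le_eq mult.commute)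
    have eq: "\<bar>x $ i\<bar> = u $ i * r" using i u(2)[of i] by simp
    obtain j where "j < n" "x $ j \<noteq> 0"
      using x(1,2) by (metis carrier_vecD eq_vecI index_zero_vec)
    then have "u $ j * r > 0" using r[of j] by linarith
    then have xi: "\<bar>x $ i\<bar> > 0"
      unfolding eq using u(2) \<open>j < n\<close> i(1) by (simp add: zero_less_mult_iff order_less_not_sym)
    have "\<bar>e\<bar> * \<bar>x $ i\<bar> = \<bar>\<Sum>j<n. M $$ (i, j) * x $ j\<bar>"
      using mult[OF i(1) x(1)] x i(1) by (simp flip: abs_mult)
    also have "\<dots> \<le> (\<Sum>j<n. M $$ (i, j) * (u $ j * r))"
      using r nonneg[OF i(1)]
      by (intro order.trans[OF sum_abs] sum_mono) (auto simp: abs_mult intro!: mult_left_mono)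
    also have "\<dots> = (\<Sum>j<n. M $$ (i, j) * u $ j) * r"
      by (simp add: sum_distrib_right mult.assoc)
    also have "\<dots> = \<theta> * \<bar>x $ i\<bar>"
      using mult[OF i(1) u(1)] ev u(1) i(1) eq by simp
    finally show ?thesis using xi by simp
  qed
  have len: "length (eigvals M) = n" using eigvals_char_poly(2)[OF M sym] .
  have "u \<noteq> 0\<^sub>v n" using u(2)[OF n] n by auto
  then have "eigenvalue M \<theta>"
    using M u(1) ev unfolding eigenvalue_def eigenvector_def by auto
  then obtain k where "k < n" "eigvals M ! k = \<theta>"
    using eigvals_char_poly(4)[OF M sym] len by (metis in_set_conv_nth mem_Collect_eq)
  then have "\<theta> \<le> eigvals M ! 0" using eigvals_antimono[OF M sym, of 0 k] by simp
  moreover have "eigenvalue M (eigvals M ! 0)"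
    using eigvals_char_poly(4)[OF M sym] len n nth_mem by blast
  ultimately show ?thesis using le by (simp add: order.antisym)
qed

section \<open>Forcing sequences\<close>

text \<open>The invariant that all neighbours of a vertex that has forced are coloured carries the
  induction: a vertex forced later was white until then, so no earlier forcing vertex is adjacent to
  it.\<close>

lemma forcing_sequence:
  assumes "(force G)\<^sup>*\<^sup>* B C" and "finite B"
  shows "\<exists>fs. finite C \<and> card C = card B + length fs
    \<and> (\<forall>(v, w)\<in>set fs. v \<rightarrow>\<^bsub>G\<^esub> w \<and> (\<forall>u. v \<rightarrow>\<^bsub>G\<^esub> u \<longrightarrow> u \<in> C))
    \<and> sorted_wrt (\<lambda>(v, _) (_, w). \<not> v \<rightarrow>\<^bsub>G\<^esub> w) fs"
  using assms
proof (induction rule: rtranclp_induct)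
  case base
  then show ?case by (intro exI[of _ "[]"]) simp
next
  case (step C D)
  then obtain fs where fs: "finite C" "card C = card B + length fs"
      "\<forall>(v, w)\<in>set fs. v \<rightarrow>\<^bsub>G\<^esub> w \<and> (\<forall>u. v \<rightarrow>\<^bsub>G\<^esub> u \<longrightarrow> u \<in> C)"
      "sorted_wrt (\<lambda>(v, _) (_, w). \<not> v \<rightarrow>\<^bsub>G\<^esub> w) fs"
    by blast
  from step.hyps(2) obtain v w where vw: "D = insert w C" "{u. v \<rightarrow>\<^bsub>G\<^esub> u \<and> u \<notin> C} = {w}"
    by (cases rule: force.cases) auto
  then have "v \<rightarrow>\<^bsub>G\<^esub> w" "w \<notin> C" "\<forall>u. v \<rightarrow>\<^bsub>G\<^esub> u \<longrightarrow> u \<in> D" by blast+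
  then show ?case
    using fs vw(1) by (intro exI[of _ "fs @ [(v, w)]"]) (force simp: sorted_wrt_append)
qed

definition half_weight :: "nat \<Rightarrow> nat \<Rightarrow> real" where
  "half_weight t i = (if 2 * i + 1 < t then 1 else if 2 * i + 1 = t then 1 / 2 else 0)"

text \<open>The weights at \<open>i\<close> and at the mirrored index \<open>t - Suc i\<close> add
  up to 1, whatever the parity of \<open>t\<close>.\<close>

lemma sum_half_weight: "(\<Sum>i<t. half_weight t i) = real t / 2"
proof -
  have "2 * (\<Sum>i<t. half_weight t i)
      = (\<Sum>i<t. half_weight t i) + (\<Sum>i<t. half_weight t (t - Suc i))"
    by (simp add: sum.nat_diff_reindex)
  also have "\<dots> = (\<Sum>i<t. half_weight t i + half_weight t (t - Suc i))"
    by (simp add: sum.distrib)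
  also have "\<dots> = (\<Sum>i<t. 1)"
    by (intro sum.cong) (auto simp: half_weight_def)
  finally show ?thesis by simp
qed

text \<open>Transports weights on indices to weights on vertices along an injection. Writing
  \<open>c\<close> as a sum avoids an inverse of \<open>p\<close> and gives 0 outside the
  image.\<close>

lemma injective_weights:
  fixes p :: "nat \<Rightarrow> 'a" and g :: "nat \<Rightarrow> real"
  assumes inj: "inj_on p {..<t}" and V: "finite V" "\<And>i. i < t \<Longrightarrow> p i \<in> V"
    and g: "\<And>i. g i \<in> {0..1}"
  defines "c \<equiv> \<lambda>x. \<Sum>i<t. if p i = x then g i else 0"
  shows "\<And>i. i < t \<Longrightarrow> c (p i) = g i"
    and "\<And>x. c x \<in> {0..1}"
    and "\<And>x. c x \<noteq> 0 \<Longrightarrow> \<exists>i<t. x = p i"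
    and "(\<Sum>x\<in>V. c x) = (\<Sum>i<t. g i)"
proof -
  show 1: "c (p i) = g i" if "i < t" for i
  proof -
    have "c (p i) = (\<Sum>j<t. if j = i then g i else 0)"
      unfolding c_def using inj that by (intro sum.cong) (auto simp: inj_on_def)
    then show ?thesis using that by simp
  qed
  show 2: "\<exists>i<t. x = p i" if "c x \<noteq> 0" for x
  proof (rule ccontr)
    assume "\<not> ?thesis"
    then have "c x = 0" unfolding c_def by (intro sum.neutral) auto
    with that show False by contradiction
  qed
  show "c x \<in> {0..1}" for x
  proof (cases "c x = 0")
    case False
    then obtain i where "i < t" "x = p i" using 2 by blast
    then show ?thesis using 1 g[of i] by simp
  qed simp
  have "(\<Sum>x\<in>V. c x) = (\<Sum>i<t. \<Sum>x\<in>V. if p i = x then g i else 0)"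
    unfolding c_def by (rule sum.swap)
  also have "\<dots> = (\<Sum>i<t. g i)"
    using V by (intro sum.cong) auto
  finally show "(\<Sum>x\<in>V. c x) = (\<Sum>i<t. g i)" .
qed

text \<open>\<open>c\<close> puts \<open>half_weight\<close> on the forcing vertices, favouring
  early ones, and \<open>d\<close> puts the complementary weight on the forced vertices, favouring
  late ones. Both total half the number of forces. Arcs between the two supports are excluded except
  possibly at the middle force, which exists only when that number is odd.\<close>

lemma forcing_weights:
  assumes "wf_digraph G" and fin: "finite (verts G)" and B: "zero_forcing_set G B"
  shows "\<exists>c d :: 'a \<Rightarrow> real. (\<forall>x. c x \<in> {0..1}) \<and> (\<forall>x. d x \<in> {0..1})
    \<and> (\<Sum>x\<in>verts G. c x) = (real (card (verts G)) - real (card B)) / 2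
    \<and> (\<Sum>x\<in>verts G. d x) = (real (card (verts G)) - real (card B)) / 2
    \<and> ((\<forall>x y. x \<rightarrow>\<^bsub>G\<^esub> y \<longrightarrow> c x * d y = 0)
      \<or> (\<exists>p q. p \<rightarrow>\<^bsub>G\<^esub> q \<and> c p = 1 / 2 \<and> d q = 1 / 2
          \<and> (\<forall>x y. x \<rightarrow>\<^bsub>G\<^esub> y \<and> c x * d y \<noteq> 0 \<longrightarrow> x = p \<and> y = q)))"
proof -
  interpret wf_digraph G by fact
  have "finite B" using B fin finite_subset unfolding zero_forcing_set_def by blast
  then obtain fs where card: "card (verts G) = card B + length fs"
    and fs: "\<forall>(v, w)\<in>set fs. v \<rightarrow>\<^bsub>G\<^esub> w"
    and sorted: "sorted_wrt (\<lambda>(v, _) (_, w). \<not> v \<rightarrow>\<^bsub>G\<^esub> w) fs"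
    using forcing_sequence[of G B "verts G"] B unfolding zero_forcing_set_def by blast
  define t where "t = length fs"
  define v w where "v i = fst (fs ! i)" and "w i = snd (fs ! i)" for i
  have arc: "v i \<rightarrow>\<^bsub>G\<^esub> w i" if "i < t" for i
    using fs nth_mem[of i fs] that by (auto simp: v_def w_def t_def split: prod.splits)
  have nonarc: "\<not> v i \<rightarrow>\<^bsub>G\<^esub> w j" if "i < j" "j < t" for i j
    using sorted_wrt_nth_less[OF sorted that(1)] that(2) by (simp add: v_def w_def t_def case_prod_beta)
  \<comment> \<open>A repetition would turn the arc of force \<open>j\<close> or of force
    \<open>i\<close> into the excluded arc from \<open>v i\<close> to \<open>w j\<close>.\<close>
  have "v i \<noteq> v j" "w i \<noteq> w j" if "i < j" "j < t" for i j
    using arc[of i] arc[of j] nonarc[of i j] that by auto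
  then have inj: "inj_on v {..<t}" "inj_on w {..<t}"
    by (auto intro!: linorder_inj_onI)
  have V: "v i \<in> verts G" "w i \<in> verts G" if "i < t" for i
    using arc[OF that] adj_in_verts by auto
  have g: "half_weight t i \<in> {0..1}" "1 - half_weight t i \<in> {0..1}" for i
    by (auto simp: half_weight_def)
  define c d where "c x = (\<Sum>i<t. if v i = x then half_weight t i else 0)"
    and "d x = (\<Sum>i<t. if w i = x then 1 - half_weight t i else 0)" for x
  note C = injective_weights[where g = "half_weight t", OF inj(1) fin V(1) g(1), folded c_def]
  note D = injective_weights[where g = "\<lambda>i. 1 - half_weight t i", OF inj(2) fin V(2) g(2), folded d_def]
  \<comment> \<open>Nonzero weights give \<open>2 * i + 1 \<le> t \<le> 2 * j + 1\<close>, hence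
    \<open>i \<le> j\<close>, while the arc rules out \<open>i < j\<close>.\<close>
  have meet: "\<exists>i<t. x = v i \<and> y = w i \<and> 2 * i + 1 = t" if xy: "x \<rightarrow>\<^bsub>G\<^esub> y" "c x * d y \<noteq> 0" for x y
  proof -
    obtain i j where ij: "i < t" "x = v i" "j < t" "y = w j"
      using C(3)[of x] D(3)[of y] xy(2) by auto
    then have "half_weight t i \<noteq> 0" "half_weight t j \<noteq> 1"
      using xy(2) C(1) D(1) by auto
    then have "2 * i + 1 \<le> t" "t \<le> 2 * j + 1" by (auto simp: half_weight_def split: if_splits)
    moreover have "\<not> i < j" using nonarc[of i j] ij xy(1) by auto
    ultimately have "j = i" "2 * i + 1 = t" by linarith+
    then show ?thesis using ij by blast
  qed
  show ?thesis
  proof (rule exI[of _ c], rule exI[of _ d], intro conjI allI)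
    show "c x \<in> {0..1}" "d x \<in> {0..1}" for x using C(2) D(2) by auto
    show "(\<Sum>x\<in>verts G. c x) = (real (card (verts G)) - real (card B)) / 2"
      using C(4) sum_half_weight[of t] card by (simp add: c_def[abs_def] t_def)
    show "(\<Sum>x\<in>verts G. d x) = (real (card (verts G)) - real (card B)) / 2"
      using D(4) sum_half_weight[of t] card by (simp add: d_def[abs_def] t_def sum_subtractf)
    show "(\<forall>x y. x \<rightarrow>\<^bsub>G\<^esub> y \<longrightarrow> c x * d y = 0)
      \<or> (\<exists>p q. p \<rightarrow>\<^bsub>G\<^esub> q \<and> c p = 1 / 2 \<and> d q = 1 / 2
          \<and> (\<forall>x y. x \<rightarrow>\<^bsub>G\<^esub> y \<and> c x * d y \<noteq> 0 \<longrightarrow> x = p \<and> y = q))"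
    proof (cases "odd t")
      case True
      define i where "i = t div 2"
      have i: "2 * i + 1 = t" "i < t" using True by (auto simp: i_def elim: oddE)
      have "c (v i) = 1 / 2" "d (w i) = 1 / 2"
        using C(1) D(1) i by (auto simp: half_weight_def)
      moreover have "x = v i \<and> y = w i" if xy: "x \<rightarrow>\<^bsub>G\<^esub> y" "c x * d y \<noteq> 0" for x y
      proof -
        obtain j where "x = v j" "y = w j" "2 * j + 1 = t" using meet[OF xy] by blast
        moreover from this have "j = i" using i(1) by simp
        ultimately show ?thesis by simp
      qed
      ultimately show ?thesis using arc[OF i(2)] by blast
    next
      case False
      then have "2 * i + 1 \<noteq> t" for i by auto
      then show ?thesis using meet by blast
    qed
  qed
qed

section \<open>Zero forcing and eigenvalues\<close>

text \<open>The common core for both matrices: \<open>M\<close> is any symmetric matrix supported on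
  arcs. With total weight \<open>s\<close> on each side, a mass is at least \<open>lo * s\<close>
  and its complement at most \<open>hi * (n - s)\<close>. The first conclusion uses both estimates;
  the second uses only \<open>lo\<close> and bounds the complements by
  \<open>sqrt_mult_complement_le\<close>.\<close>

lemma zero_forcing_eigval_bounds:
  fixes G :: "('a, 'b) pre_digraph" and M :: "real mat" and lo hi :: real
  assumes "graph G" and vs: "distinct vs" "set vs = verts G" and n: "n = length vs" "n \<ge> 2"
    and M: "M \<in> carrier_mat n n" and sym: "M\<^sup>T = M"
    and adj: "\<And>i j. i < n \<Longrightarrow> j < n \<Longrightarrow> \<not> vs ! i \<rightarrow>\<^bsub>G\<^esub> vs ! j \<Longrightarrow> M $$ (i, j) = 0"
    and v: "v \<in> carrier_vec n" "v \<bullet> v = 1" "M *\<^sub>v v = eigvals M ! 0 \<cdot>\<^sub>v v"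
    and pos: "\<And>i. i < n \<Longrightarrow> v $ i \<ge> 0" and ev0: "eigvals M ! 0 \<ge> 0"
    and lo: "0 \<le> lo" "\<And>i. i < n \<Longrightarrow> lo \<le> (v $ i)\<^sup>2" and hi: "\<And>i. i < n \<Longrightarrow> (v $ i)\<^sup>2 \<le> hi"
    and B: "zero_forcing_set G B"
  defines "\<mu> \<equiv> max \<bar>eigvals M ! 1\<bar> \<bar>eigvals M ! (n - 1)\<bar>"
  shows "(real n - real (card B)) * (eigvals M ! 0 * lo + \<mu> * hi) \<le> 2 * real n * \<mu> * hi"
    and "(real n - real (card B)) * (lo * (eigvals M ! 0 + \<mu>)) \<le> 2 * \<mu>"
proof -
  interpret graph G by fact
  have cardV: "card (verts G) = n" using vs n distinct_card by metis
  have \<mu>0: "\<mu> \<ge> 0" by (simp add: \<mu>_def)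
  define s where "s = (real n - real (card B)) / 2"
  from forcing_weights[OF wf_digraph finite_verts B] obtain c d where
    "(\<forall>x. c x \<in> {0..1}) \<and> (\<forall>x. d x \<in> {0..1})
    \<and> (\<Sum>x\<in>verts G. c x) = (real (card (verts G)) - real (card B)) / 2
    \<and> (\<Sum>x\<in>verts G. d x) = (real (card (verts G)) - real (card B)) / 2
    \<and> ((\<forall>x y. x \<rightarrow>\<^bsub>G\<^esub> y \<longrightarrow> c x * d y = 0)
      \<or> (\<exists>p q. p \<rightarrow>\<^bsub>G\<^esub> q \<and> c p = 1 / 2 \<and> d q = 1 / 2
          \<and> (\<forall>x y. x \<rightarrow>\<^bsub>G\<^esub> y \<and> c x * d y \<noteq> 0 \<longrightarrow> x = p \<and> y = q)))"
    by (elim exE)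
  then have c: "\<And>x. c x \<in> {0..1}" and d: "\<And>x. d x \<in> {0..1}"
    and sum_cd: "(\<Sum>x\<in>verts G. c x) = s" "(\<Sum>x\<in>verts G. d x) = s"
    and arcs: "(\<forall>x y. x \<rightarrow>\<^bsub>G\<^esub> y \<longrightarrow> c x * d y = 0)
      \<or> (\<exists>p q. p \<rightarrow>\<^bsub>G\<^esub> q \<and> c p = 1 / 2 \<and> d q = 1 / 2
          \<and> (\<forall>x y. x \<rightarrow>\<^bsub>G\<^esub> y \<and> c x * d y \<noteq> 0 \<longrightarrow> x = p \<and> y = q))"
    unfolding cardV s_def by blast+
  define C D where "C i = c (vs ! i)" and "D i = d (vs ! i)" for i
  have range: "C i \<in> {0..1}" "D i \<in> {0..1}" for i using c d by (auto simp: C_def D_def)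
  have bij: "bij_betw ((!) vs) {..<n} (verts G)"
    using vs n by (intro bij_betw_nth) auto
  have sums: "(\<Sum>i<n. C i) = s" "(\<Sum>i<n. D i) = s"
    using sum.reindex_bij_betw[OF bij, of c] sum.reindex_bij_betw[OF bij, of d] sum_cd
    by (simp_all add: C_def D_def)
  define h where "h C = (\<Sum>i<n. C i * (1 - C i) * (v $ i)\<^sup>2)" for C :: "nat \<Rightarrow> real"
  have h_ge: "h C \<ge> 0" "p < n \<Longrightarrow> C p * (1 - C p) * (v $ p)\<^sup>2 \<le> h C"
    if "\<And>i. C i \<in> {0..1}" for C p
  proof -
    have nonneg: "C i * (1 - C i) * (v $ i)\<^sup>2 \<ge> 0" for i using that[of i] by auto
    then show "h C \<ge> 0" unfolding h_def by (intro sum_nonneg)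
    show "C p * (1 - C p) * (v $ p)\<^sup>2 \<le> h C" if "p < n"
      unfolding h_def using nonneg that
      by (intro member_le_sum[of p "{..<n}" "\<lambda>i. C i * (1 - C i) * (v $ i)\<^sup>2"]) auto
  qed
  have vanish: "C i * v $ i * (M $$ (i, j) * (D j * v $ j)) = 0"
    if "i < n" "j < n" "vs ! i \<rightarrow>\<^bsub>G\<^esub> vs ! j \<Longrightarrow> C i * D j = 0" for i j
    using adj[OF that(1,2)] that(3) by auto
  have le: "(\<Sum>i<n. \<Sum>j<n. C i * v $ i * (M $$ (i, j) * (D j * v $ j)))
      \<le> \<mu> * (sqrt (h C) * sqrt (h D))"
    using arcs
  proof
    assume "\<forall>x y. x \<rightarrow>\<^bsub>G\<^esub> y \<longrightarrow> c x * d y = 0"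
    then have "(\<Sum>i<n. \<Sum>j<n. C i * v $ i * (M $$ (i, j) * (D j * v $ j))) = 0"
      by (intro sum.neutral ballI vanish) (auto simp: C_def D_def)
    then show ?thesis using \<mu>0 h_ge(1) range by simp
  next
    assume "\<exists>p q. p \<rightarrow>\<^bsub>G\<^esub> q \<and> c p = 1 / 2 \<and> d q = 1 / 2
          \<and> (\<forall>x y. x \<rightarrow>\<^bsub>G\<^esub> y \<and> c x * d y \<noteq> 0 \<longrightarrow> x = p \<and> y = q)"
    then obtain x y where xy: "x \<rightarrow>\<^bsub>G\<^esub> y" "c x = 1 / 2" "d y = 1 / 2"
      and only: "\<And>x' y'. x' \<rightarrow>\<^bsub>G\<^esub> y' \<Longrightarrow> c x' * d y' \<noteq> 0 \<Longrightarrow> x' = x \<and> y' = y" by blast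
    obtain p q where pq: "p < n" "vs ! p = x" "q < n" "vs ! q = y"
      using adj_in_verts[OF xy(1)] vs n by (metis in_set_conv_nth)
    have CD: "C p = 1 / 2" "D q = 1 / 2" unfolding C_def D_def pq xy by auto
    have "p \<noteq> q" using adj_not_same xy(1) pq by auto
    have "(\<Sum>j<n. C i * v $ i * (M $$ (i, j) * (D j * v $ j)))
        = (if i = p then v $ p * M $$ (p, q) * v $ q / 4 else 0)" if "i < n" for i
    proof -
      have "C i * v $ i * (M $$ (i, j) * (D j * v $ j))
          = (if j = q then if i = p then v $ p * M $$ (p, q) * v $ q / 4 else 0 else 0)" if "j < n" for j
      proof (cases "i = p \<and> j = q")
        case True
        then show ?thesis using pq by (simp add: CD)
      next
        case False
        then have "\<not> (vs ! i = x \<and> vs ! j = y)"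
          using pq \<open>i < n\<close> \<open>j < n\<close> vs(1) n(1) by (auto simp: nth_eq_iff_index_eq)
        then have "C i * v $ i * (M $$ (i, j) * (D j * v $ j)) = 0"
          using only[of "vs ! i" "vs ! j"] \<open>i < n\<close> \<open>j < n\<close> by (intro vanish) (auto simp: C_def D_def)
        then show ?thesis using False by auto
      qed
      then show ?thesis using pq(3) by simp
    qed
    then have "(\<Sum>i<n. \<Sum>j<n. C i * v $ i * (M $$ (i, j) * (D j * v $ j)))
        = M $$ (p, q) * (v $ p / 2 * (v $ q / 2))"
      using pq(1) by simp
    also have "\<dots> \<le> \<mu> * (sqrt (h C) * sqrt (h D))"
    proof (rule mult_mono)
      have "\<not> vs ! i \<rightarrow>\<^bsub>G\<^esub> vs ! i" for i using adj_not_same by blast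
      then have "M $$ (p, p) = 0" "M $$ (q, q) = 0" using adj pq(1,3) by auto
      from entry_le_abs_least_eigval[OF M sym pq(1,3) \<open>p \<noteq> q\<close> this]
      show "M $$ (p, q) \<le> \<mu>" by (simp add: \<mu>_def)
      \<comment> \<open>Index \<open>p\<close> alone contributes \<open>1/2 * (1 - 1/2)\<close>
        times the square of \<open>v $ p\<close> to \<open>h C\<close>, and similarly
        \<open>q\<close> to \<open>h D\<close>; so the losses pay for the middle edge.\<close>
      show "v $ p / 2 * (v $ q / 2) \<le> sqrt (h C) * sqrt (h D)"
      proof (intro mult_mono real_le_rsqrt)
        show "(v $ p / 2)\<^sup>2 \<le> h C"
          using h_ge(2)[of C p, OF range(1) pq(1)] by (simp add: CD power_divide)
        show "(v $ q / 2)\<^sup>2 \<le> h D"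
          using h_ge(2)[of D q, OF range(2) pq(3)] by (simp add: CD power_divide)
      qed (use pos pq h_ge(1)[of C, OF range(1)] in auto)
    qed (use \<mu>0 pos pq in auto)
    finally show ?thesis .
  qed
  define a b where "a = (\<Sum>i<n. C i * (v $ i)\<^sup>2)" and "b = (\<Sum>i<n. D i * (v $ i)\<^sup>2)"
  have vv: "(\<Sum>i<n. (v $ i)\<^sup>2) = 1"
    using v(1,2) by (simp add: scalar_prod_def atLeast0LessThan power2_eq_square)
  have w: "lo * s \<le> (\<Sum>i<n. C i * (v $ i)\<^sup>2)" "1 - (\<Sum>i<n. C i * (v $ i)\<^sup>2) \<le> hi * (n - s)"
    "(\<Sum>i<n. C i * (v $ i)\<^sup>2) \<in> {0..1}"
    if "\<And>i. C i \<in> {0..1}" "(\<Sum>i<n. C i) = s" for C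
  proof -
    have "lo * s = (\<Sum>i<n. C i * lo)" unfolding that(2)[symmetric]
      by (simp add: sum_distrib_left mult.commute)
    also have "\<dots> \<le> (\<Sum>i<n. C i * (v $ i)\<^sup>2)"
      using that(1) lo by (intro sum_mono mult_left_mono) auto
    finally show "lo * s \<le> (\<Sum>i<n. C i * (v $ i)\<^sup>2)" .
    have eq: "1 - (\<Sum>i<n. C i * (v $ i)\<^sup>2) = (\<Sum>i<n. (1 - C i) * (v $ i)\<^sup>2)"
      using vv by (simp add: left_diff_distrib sum_subtractf)
    also have "\<dots> \<le> (\<Sum>i<n. (1 - C i) * hi)"
      using that(1) hi by (intro sum_mono mult_left_mono) auto
    also have "\<dots> = (n - s) * hi"
      by (simp add: sum_subtractf that(2) flip: sum_distrib_right)
    also have "\<dots> = hi * (n - s)" by (rule mult.commute)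
    finally show "1 - (\<Sum>i<n. C i * (v $ i)\<^sup>2) \<le> hi * (n - s)" .
    have "(\<Sum>i<n. (1 - C i) * (v $ i)\<^sup>2) \<ge> 0" using that(1) by (intro sum_nonneg) auto
    moreover have "(\<Sum>i<n. C i * (v $ i)\<^sup>2) \<ge> 0" using that(1) by (intro sum_nonneg) auto
    ultimately show "(\<Sum>i<n. C i * (v $ i)\<^sup>2) \<in> {0..1}" using eq by simp
  qed
  have a: "lo * s \<le> a" "1 - a \<le> hi * (n - s)" "a \<in> {0..1}"
    unfolding a_def using w[of C, OF range(1) sums(1)] by auto
  have b: "lo * s \<le> b" "1 - b \<le> hi * (n - s)" "b \<in> {0..1}"
    unfolding b_def using w[of D, OF range(2) sums(2)] by auto
  have main: "eigvals M ! 0 * sqrt (a * b) \<le> \<mu> * sqrt ((1 - a) * (1 - b))"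
    unfolding a_def b_def \<mu>_def
    by (rule weighted_expander_mixing[OF M sym n(2) v range le[unfolded h_def \<mu>_def]])
  have s0: "s \<ge> 0"
    unfolding sum_cd(1)[symmetric] using c by (intro sum_nonneg) auto
  have "(lo * s)\<^sup>2 \<le> a * b"
    unfolding power2_eq_square using a b lo s0 by (intro mult_mono) auto
  then have sab: "lo * s \<le> sqrt (a * b)" by (rule real_le_rsqrt)
  have "(1 - a) * (1 - b) \<le> (hi * (n - s))\<^sup>2"
    unfolding power2_eq_square using a b by (intro mult_mono) auto
  then have sab': "sqrt ((1 - a) * (1 - b)) \<le> hi * (n - s)"
    using a by (intro real_le_lsqrt) auto
  have "eigvals M ! 0 * (lo * s) \<le> \<mu> * (hi * (n - s))"
    using main mult_left_mono[OF sab ev0] mult_left_mono[OF sab' \<mu>0] by linarith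
  then show "(real n - real (card B)) * (eigvals M ! 0 * lo + \<mu> * hi) \<le> 2 * real n * \<mu> * hi"
    by (simp add: s_def field_simps)
  have "eigvals M ! 0 * (lo * s) \<le> \<mu> * (1 - lo * s)"
    using main mult_left_mono[OF sab ev0] mult_left_mono[OF sab \<mu>0]
      mult_left_mono[OF sqrt_mult_complement_le[OF a(3) b(3)] \<mu>0]
    unfolding right_diff_distrib by linarith
  then show "(real n - real (card B)) * (lo * (eigvals M ! 0 + \<mu>)) \<le> 2 * \<mu>"
    by (simp add: s_def field_simps)
qed

section \<open>Adjacency matrices, degrees and the normalized bound\<close>

lemma adj_matrix_carrier [simp]: "adj_matrix G vs \<in> carrier_mat (length vs) (length vs)"
  by (simp add: adj_matrix_def)

lemma adj_matrix_index:
  "i < length vs \<Longrightarrow> j < length vs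
    \<Longrightarrow> adj_matrix G vs $$ (i, j) = (if vs ! i \<rightarrow>\<^bsub>G\<^esub> vs ! j then 1 else 0)"
  by (simp add: adj_matrix_def)

lemma normalized_adj_matrix_eq:
  "normalized_adj_matrix G vs = mat (length vs) (length vs) (\<lambda>(i, j). adj_matrix G vs $$ (i, j)
    / (sqrt (out_degree G (vs ! i)) * sqrt (out_degree G (vs ! j))))"
proof -
  let ?n = "length vs"
  have "normalized_adj_matrix G vs = mat ?n ?n (\<lambda>(i, j). 1 / sqrt (out_degree G (vs ! i))
      * adj_matrix G vs $$ (i, j)) * inv_sqrt_degree_matrix G vs"
    unfolding normalized_adj_matrix_def inv_sqrt_degree_matrix_def
    by (subst mat_diag_mult_left[of _ ?n ?n]) auto
  also have "\<dots> = mat ?n ?n (\<lambda>(i, j). adj_matrix G vs $$ (i, j)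
    / (sqrt (out_degree G (vs ! i)) * sqrt (out_degree G (vs ! j))))"
    unfolding inv_sqrt_degree_matrix_def
    by (subst mat_diag_mult_right[of _ ?n ?n]) (auto intro!: eq_matI)
  finally show ?thesis .
qed

context graph
begin

text \<open>\<open>out_degree\<close> counts arcs while the adjacency matrix sees neighbours;
  without parallel arcs \<open>head G\<close> is injective on the arcs leaving
  \<open>x\<close>.\<close>

lemma out_degree_eq_card_neighbors: "out_degree G x = card {y. x \<rightarrow>\<^bsub>G\<^esub> y}"
proof -
  have "inj_on (head G) (out_arcs G x)"
    using no_multi_arcs by (auto simp: inj_on_def arc_to_ends_def)
  moreover have "head G ` out_arcs G x = {y. x \<rightarrow>\<^bsub>G\<^esub> y}"
    by (auto simp: arcs_ends_conv image_iff)
  ultimately show ?thesis unfolding out_degree_def using card_image by metis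
qed

lemma adj_commute: "x \<rightarrow>\<^bsub>G\<^esub> y \<longleftrightarrow> y \<rightarrow>\<^bsub>G\<^esub> x"
  using arcs_ends_symmetric[OF sym_arcs] by blast

lemma adj_matrix_sym: "(adj_matrix G vs)\<^sup>T = adj_matrix G vs"
  by (intro eq_matI) (auto simp: adj_matrix_def adj_commute)

lemma normalized_adj_matrix_sym: "(normalized_adj_matrix G vs)\<^sup>T = normalized_adj_matrix G vs"
  unfolding normalized_adj_matrix_eq
  by (intro eq_matI) (auto simp: adj_matrix_index adj_commute mult.commute)

lemma adj_matrix_row_sum:
  assumes "distinct vs" "set vs = verts G" "i < length vs"
  shows "(\<Sum>j<length vs. adj_matrix G vs $$ (i, j)) = out_degree G (vs ! i)"
proof -
  have bij: "bij_betw ((!) vs) {..<length vs} (verts G)"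
    using assms by (intro bij_betw_nth) auto
  have "(\<Sum>j<length vs. adj_matrix G vs $$ (i, j))
      = (\<Sum>j<length vs. (\<lambda>y. if vs ! i \<rightarrow>\<^bsub>G\<^esub> y then 1 else 0 :: real) (vs ! j))"
    using assms(3) by (intro sum.cong) (auto simp: adj_matrix_index)
  also have "\<dots> = (\<Sum>y\<in>verts G. if vs ! i \<rightarrow>\<^bsub>G\<^esub> y then 1 else 0)"
    by (rule sum.reindex_bij_betw[OF bij])
  also have "\<dots> = card {y. vs ! i \<rightarrow>\<^bsub>G\<^esub> y}"
    using adj_in_verts by (auto simp: sum.If_cases Int_def intro!: arg_cong[of _ _ card])
  finally show ?thesis by (simp add: out_degree_eq_card_neighbors)
qed

text \<open>A walk from \<open>x\<close> to some other vertex has a first arc, and symmetry of the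
  arcs makes such a directed walk available.\<close>

lemma connected_out_degree_pos:
  assumes "Digraph_Component.connected G" and "card (verts G) \<ge> 2" and "x \<in> verts G"
  shows "out_degree G x > 0"
proof -
  obtain y where y: "y \<in> verts G" "y \<noteq> x"
    using assms(2,3) by (metis card_le_Suc0_iff_eq finite_verts not_less_eq_eq numeral_2_eq_2)
  have "x \<rightarrow>\<^sup>*\<^bsub>G\<^esub> y"
    using symmetric_connected_imp_strongly_connected[OF sym_arcs assms(1)] assms(3) y(1)
    by (auto elim: strongly_connectedE)
  then obtain z where "x \<rightarrow>\<^bsub>G\<^esub> z"
    using y(2) by (cases rule: converse_reachable_cases) auto
  moreover have "finite {y. x \<rightarrow>\<^bsub>G\<^esub> y}"
    using adj_in_verts by (auto intro: finite_subset[OF _ finite_verts])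
  ultimately show ?thesis
    unfolding out_degree_eq_card_neighbors by (auto simp: card_gt_0_iff)
qed

text \<open>The \<open>Min\<close> is taken over a finite set, which is nonempty because the full
  vertex set is zero forcing.\<close>

lemma zero_forcing_number_attained: "\<exists>B. zero_forcing_set G B \<and> card B = zero_forcing_number G"
proof -
  have "{B. zero_forcing_set G B} \<subseteq> Pow (verts G)" by (auto simp: zero_forcing_set_def)
  then have "finite {B. zero_forcing_set G B}" by (rule finite_subset) simp
  moreover have "zero_forcing_set G (verts G)" by (simp add: zero_forcing_set_def)
  ultimately have "zero_forcing_number G \<in> card ` {B. zero_forcing_set G B}"
    unfolding zero_forcing_number_def by (intro Min_in) auto
  then show ?thesis by auto
qed

text \<open>Multiplying by the square root of degree \<open>j\<close> cancels the column factor, and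
  the row sum then supplies degree \<open>i\<close>. The scale \<open>w\<close> is left open and
  later becomes the degree sum, which makes the vector a unit vector.\<close>

lemma normalized_adj_matrix_eigenvector:
  assumes vs: "distinct vs" "set vs = verts G" and deg: "\<And>x. x \<in> verts G \<Longrightarrow> out_degree G x > 0"
  shows "normalized_adj_matrix G vs *\<^sub>v vec (length vs) (\<lambda>i. sqrt (out_degree G (vs ! i) / w))
    = vec (length vs) (\<lambda>i. sqrt (out_degree G (vs ! i) / w))"
proof (rule eq_vecI)
  fix i assume "i < dim_vec (vec (length vs) (\<lambda>i. sqrt (out_degree G (vs ! i) / w)))"
  then have i: "i < length vs" by simp
  let ?d = "\<lambda>i. real (out_degree G (vs ! i))"
  have d: "?d j > 0" if "j < length vs" for j using deg[of "vs ! j"] vs(2) that nth_mem by fastforce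
  have "(normalized_adj_matrix G vs *\<^sub>v vec (length vs) (\<lambda>i. sqrt (?d i / w))) $ i
      = (\<Sum>j<length vs. adj_matrix G vs $$ (i, j) / (sqrt (?d i) * sqrt (?d j)) * sqrt (?d j / w))"
    using i by (simp add: normalized_adj_matrix_eq scalar_prod_def atLeast0LessThan)
  also have "\<dots> = (\<Sum>j<length vs. adj_matrix G vs $$ (i, j) * (1 / (sqrt (?d i) * sqrt w)))"
    using d by (intro sum.cong) (auto simp: real_sqrt_divide)
  also have "\<dots> = ?d i / (sqrt (?d i) * sqrt w)"
    using adj_matrix_row_sum[OF vs i] by (simp flip: sum_divide_distrib)
  also have "\<dots> = sqrt (?d i / w)"
    using d[OF i] by (simp add: real_sqrt_divide real_div_sqrt flip: divide_divide_eq_left)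
  finally show "(normalized_adj_matrix G vs *\<^sub>v vec (length vs) (\<lambda>i. sqrt (?d i / w))) $ i
    = vec (length vs) (\<lambda>i. sqrt (?d i / w)) $ i" using i by simp
qed (simp add: normalized_adj_matrix_eq)

text \<open>The unit Perron vector has squared entries degree over \<open>w\<close>, so
  \<open>lo\<close> and \<open>hi\<close> are the extreme degrees over \<open>w\<close>. The top
  eigenvalue is 1 and \<open>w\<close> cancels.\<close>

lemma zero_forcing_normalized_bound:
  fixes \<sigma> :: real
  assumes conn: "Digraph_Component.connected G" and vs: "distinct vs" "set vs = verts G"
    and n: "n = card (verts G)" "n \<ge> 2" and B: "zero_forcing_set G B"
  defines "\<sigma> \<equiv> max \<bar>eigvals (normalized_adj_matrix G vs) ! 1\<bar>
    \<bar>eigvals (normalized_adj_matrix G vs) ! (n - 1)\<bar>"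
  shows "(real n - real (card B)) * (min_degree G + \<sigma> * max_degree G)
    \<le> 2 * real n * \<sigma> * max_degree G"
proof -
  let ?N = "normalized_adj_matrix G vs"
  have len: "n = length vs" using vs n(1) distinct_card by metis
  define d where "d i = real (out_degree G (vs ! i))" for i
  define w where "w = (\<Sum>i<n. d i)"
  define u where "u = vec n (\<lambda>i. sqrt (d i / w))"
  have in_verts: "vs ! i \<in> verts G" if "i < n" for i using that len vs(2) nth_mem by metis
  have d: "d i > 0" if "i < n" for i
    unfolding d_def using connected_out_degree_pos[OF conn] n in_verts[OF that] by simp
  then have w: "w > 0" unfolding w_def using n(2) by (intro sum_pos) (auto simp: lessThan_empty_iff)
  have N: "?N \<in> carrier_mat n n" by (simp add: normalized_adj_matrix_eq len)
  have u: "u \<in> carrier_vec n" by (simp add: u_def)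
  have u2: "(u $ i)\<^sup>2 = d i / w" if "i < n" for i
    using d[OF that] w that by (simp add: u_def)
  have upos: "u $ i > 0" if "i < n" for i using d[OF that] w that by (simp add: u_def)
  have "u \<bullet> u = (\<Sum>i<n. (u $ i)\<^sup>2)"
    using u by (simp add: scalar_prod_def atLeast0LessThan power2_eq_square)
  also have "\<dots> = (\<Sum>i<n. d i) / w" by (simp add: u2 sum_divide_distrib)
  finally have unit: "u \<bullet> u = 1" using w by (simp add: w_def)
  have ev: "?N *\<^sub>v u = 1 \<cdot>\<^sub>v u"
    using normalized_adj_matrix_eigenvector[OF vs connected_out_degree_pos[OF conn], of w] n
    by (simp add: u_def d_def len)
  have "?N $$ (i, j) \<ge> 0" if "i < n" "j < n" for i j
    using that by (simp add: normalized_adj_matrix_eq len adj_matrix_index)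
  then have ev0: "eigvals ?N ! 0 = 1"
    using n(2) by (intro eigvals_hd_of_positive_eigenvector[OF N normalized_adj_matrix_sym _ _ u upos ev]) auto
  have "(real n - real (card B)) * (eigvals ?N ! 0 * (min_degree G / w) + \<sigma> * (max_degree G / w))
      \<le> 2 * real n * \<sigma> * (max_degree G / w)"
    unfolding \<sigma>_def
  proof (rule zero_forcing_eigval_bounds(1)[OF graph_axioms vs len n(2) N normalized_adj_matrix_sym _ u unit])
    show "?N *\<^sub>v u = eigvals ?N ! 0 \<cdot>\<^sub>v u" using ev ev0 by simp
    fix i j assume "i < n" "j < n" "\<not> vs ! i \<rightarrow>\<^bsub>G\<^esub> vs ! j"
    then show "?N $$ (i, j) = 0" by (simp add: normalized_adj_matrix_eq len adj_matrix_index)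
  next
    fix i assume i: "i < n"
    show "u $ i \<ge> 0" using upos[OF i] by simp
    have "min_degree G \<le> out_degree G (vs ! i)" "out_degree G (vs ! i) \<le> max_degree G"
      unfolding min_degree_def max_degree_def using in_verts[OF i] by auto
    then show "min_degree G / w \<le> (u $ i)\<^sup>2" "(u $ i)\<^sup>2 \<le> max_degree G / w"
      using w by (auto simp: u2[OF i] d_def divide_right_mono)
  qed (use w ev0 B in auto)
  then have "(real n - real (card B)) * (min_degree G + \<sigma> * max_degree G) / w
      \<le> 2 * real n * \<sigma> * max_degree G / w"
    by (simp add: ev0 flip: add_divide_distrib)
  then show ?thesis using w by (simp add: divide_le_cancel)
qed

end

text \<open>The denominator \<open>\<delta> * (\<delta> / \<Delta> + \<sigma>)\<close> is
  \<open>\<delta> + \<sigma> * \<Delta>\<close> times \<open>\<delta> / \<Delta>\<close>, a factor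
  at most 1; the hypothesis is thus the sharper estimate.\<close>

lemma degree_quotient_bound:
  fixes t n \<delta> \<Delta> \<sigma> :: real
  assumes "t * (\<delta> + \<sigma> * \<Delta>) \<le> 2 * n * \<sigma> * \<Delta>" and "0 < \<delta>" "\<delta> \<le> \<Delta>" "0 \<le> \<sigma>" "0 \<le> t"
  shows "t \<le> n * (2 * \<sigma> * \<Delta> / (\<delta> * (\<delta> / \<Delta> + \<sigma>)))"
proof -
  have "t * \<delta> * (\<delta> / \<Delta> + \<sigma>) = t * (\<delta> + \<sigma> * \<Delta>) * (\<delta> / \<Delta>)"
    using assms by (simp add: field_simps)
  also have "\<dots> \<le> t * (\<delta> + \<sigma> * \<Delta>) * 1"
    using assms by (intro mult_left_mono) auto
  also have "\<dots> \<le> n * (2 * \<sigma> * \<Delta>)" using assms(1) by (simp add: mult_ac)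
  finally have "t * (\<delta> * (\<delta> / \<Delta> + \<sigma>)) \<le> n * (2 * \<sigma> * \<Delta>)" by (simp add: mult_ac)
  moreover have "\<delta> * (\<delta> / \<Delta> + \<sigma>) > 0" using assms by (intro mult_pos_pos add_pos_nonneg) auto
  ultimately show ?thesis by (simp add: pos_le_divide_eq)
qed

text \<open>Dividing the hypothesis by the square of \<open>b\<close> gives the estimate with the
  square of \<open>a / b\<close>. As this ratio is at most 1, passing to the fourth power only
  weakens it.\<close>

lemma ratio_power4_bound:
  fixes t n l \<mu> a b :: real
  assumes "t * (l * a\<^sup>2 + \<mu> * b\<^sup>2) \<le> 2 * n * \<mu> * b\<^sup>2" and "0 < a" "a \<le> b" "0 < l" "0 \<le> \<mu>" "0 \<le> t"
  shows "t \<le> n * (2 * \<mu> / (l * (a / b) ^ 4 + \<mu>))"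
proof -
  have r: "0 < a / b" "a / b \<le> 1" using assms by auto
  have "(a / b) ^ 4 \<le> (a / b) ^ 2" using r by (intro power_decreasing) auto
  then have "t * (l * (a / b) ^ 4 + \<mu>) \<le> t * (l * (a / b)\<^sup>2 + \<mu>)"
    using assms by (intro mult_left_mono add_right_mono) auto
  also have "\<dots> = t * (l * a\<^sup>2 + \<mu> * b\<^sup>2) / b\<^sup>2"
    using assms by (simp add: field_simps)
  also have "\<dots> \<le> 2 * n * \<mu> * b\<^sup>2 / b\<^sup>2" using assms(1) by (rule divide_right_mono) simp
  finally have "t * (l * (a / b) ^ 4 + \<mu>) \<le> n * (2 * \<mu>)" using assms by (simp add: mult_ac)
  moreover have "l * (a / b) ^ 4 + \<mu> > 0"
    using assms r by (intro add_pos_nonneg mult_pos_pos zero_less_power) auto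
  ultimately show ?thesis by (simp add: pos_le_divide_eq)
qed

section \<open>Passage to the zero forcing number\<close>

theorem theorem21:
  fixes G :: "('a, 'b) pre_digraph"
    and vs :: "'a list"
    and n :: nat
    and \<delta> \<Delta> lam1 lam \<sigma> :: real
    and ls ss :: "real list"
  assumes "graph G"
    and "Digraph_Component.connected G"
    and "distinct vs" and "set vs = verts G"
    and "n = card (verts G)" and "n \<ge> 2"
    and "\<delta> = real (min_degree G)" and "\<Delta> = real (max_degree G)"
    and "ls = eigvals (adj_matrix G vs)"
    and "ss = eigvals (normalized_adj_matrix G vs)"
    and "lam1 = ls ! 0"
    and "lam = max \<bar>ls ! 1\<bar> \<bar>ls ! (n - 1)\<bar>"
    and "\<sigma> = max \<bar>ss ! 1\<bar> \<bar>ss ! (n - 1)\<bar>"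
  shows "real (zero_forcing_number G) \<ge> real n * (1 - 2 * \<sigma> * \<Delta> / (\<delta> * (\<delta> / \<Delta> + \<sigma>)))
    \<and> (\<forall>\<nu> \<nu>min \<nu>max. normalized_perron_vector (adj_matrix G vs) \<nu>
          \<and> \<nu>min = Min (vec_set \<nu>) \<and> \<nu>max = Max (vec_set \<nu>) \<longrightarrow>
        real (zero_forcing_number G) \<ge> real n * (1 - 2 * lam / (real n * (lam + lam1) * \<nu>min ^ 2))
      \<and> real (zero_forcing_number G)
          \<ge> real n * (1 - 2 * lam / (lam1 * (\<nu>min / \<nu>max) ^ 4 + lam)))"
proof -
  interpret graph G by fact
  let ?A = "adj_matrix G vs"
  note conn = assms(2) and vs = assms(3,4) and n = assms(5,6)
  have len: "n = length vs" using vs n(1) distinct_card by metis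
  obtain B where B: "zero_forcing_set G B" and cardB: "card B = zero_forcing_number G"
    using zero_forcing_number_attained by blast
  define t where "t = real n - real (card B)"
  have "B \<subseteq> verts G" using B by (simp add: zero_forcing_set_def)
  then have t0: "t \<ge> 0" unfolding t_def n(1) using card_mono[OF finite_verts] by simp
  have deg: "out_degree G x > 0" if "x \<in> verts G" for x
    using connected_out_degree_pos[OF conn _ that] n by simp
  \<comment> \<open>Each lower bound becomes an upper bound on \<open>t\<close>, the number of
    vertices coloured by forces from an optimal set \<open>B\<close>.\<close>
  have goal: "real (zero_forcing_number G) \<ge> real n * (1 - q)" if "t \<le> real n * q" for q
    using that by (simp add: t_def cardB algebra_simps)
  have "verts G \<noteq> {}" using n by auto
  then have "min_degree G \<in> out_degree G ` verts G"
    unfolding min_degree_def by (intro Min_in) auto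
  then have "\<delta> > 0" "\<delta> \<le> \<Delta>"
    using deg unfolding assms(7,8) max_degree_def by auto
  then have 1: "t \<le> real n * (2 * \<sigma> * \<Delta> / (\<delta> * (\<delta> / \<Delta> + \<sigma>)))"
    using zero_forcing_normalized_bound[OF conn vs n B] t0
    by (intro degree_quotient_bound) (auto simp: t_def assms(7,8,10,13) le_max_iff_disj)
  have "t \<le> real n * (2 * lam / (real n * (lam + lam1) * \<nu>min ^ 2))
      \<and> t \<le> real n * (2 * lam / (lam1 * (\<nu>min / \<nu>max) ^ 4 + lam))"
    if perron: "normalized_perron_vector ?A \<nu>"
      and \<nu>min: "\<nu>min = Min (vec_set \<nu>)" and \<nu>max: "\<nu>max = Max (vec_set \<nu>)"
    for \<nu> \<nu>min \<nu>max
  proof -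
    have A: "?A \<in> carrier_mat n n" by (simp add: len)
    have \<nu>: "\<nu> \<in> carrier_vec n" "\<nu> \<bullet> \<nu> = 1" "?A *\<^sub>v \<nu> = eigvals ?A ! 0 \<cdot>\<^sub>v \<nu>"
      using perron A unfolding normalized_perron_vector_def eigenvector_def by auto
    have pos: "\<nu> $ i > 0" if "i < n" for i
      using that perron \<nu>(1) unfolding normalized_perron_vector_def by auto
    have set: "vec_set \<nu> = ($) \<nu> ` {..<n}" using \<nu>(1) by (auto simp: vec_set_def)
    have min_max: "\<nu>min \<le> \<nu> $ i" "\<nu> $ i \<le> \<nu>max" if "i < n" for i
      using that unfolding \<nu>min \<nu>max set by auto
    have "\<nu>min \<in> ($) \<nu> ` {..<n}"
      unfolding \<nu>min set using n(2) by (intro Min_in) (auto simp: lessThan_empty_iff)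
    then have min0: "\<nu>min > 0" using pos by auto
    have "\<nu>min \<le> \<nu>max" using min_max[of 0] n(2) by linarith
    \<comment> \<open>Positivity of \<open>lam1\<close> is read off row 0 of the eigenvector
      equation: the first vertex has a neighbour \<open>vs ! k\<close>, and \<open>\<nu>\<close> is
      positive.\<close>
    have row: "eigvals ?A ! 0 * \<nu> $ 0 = (\<Sum>j<n. ?A $$ (0, j) * \<nu> $ j)"
      using arg_cong[OF \<nu>(3), of "\<lambda>x. x $ 0"] \<nu>(1) A n(2)
      by (simp add: scalar_prod_def atLeast0LessThan)
    have "0 < length vs" using n(2) unfolding len by linarith
    then have "(\<Sum>j<n. ?A $$ (0, j)) > 0"
      using adj_matrix_row_sum[OF vs \<open>0 < length vs\<close>] deg[of "vs ! 0"] vs(2) nth_mem[of 0 vs]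
      by (simp only: len of_nat_0_less_iff)
    then obtain k where k: "k < n" "?A $$ (0, k) > 0"
      by (metis lessThan_iff linorder_not_less sum_nonpos)
    have "(\<Sum>j<n. ?A $$ (0, j) * \<nu> $ j) > 0"
    proof (rule sum_pos2[of _ k])
      show "0 \<le> ?A $$ (0, j) * \<nu> $ j" if "j \<in> {..<n}" for j
        using pos[of j] that \<open>0 < length vs\<close> len by (simp add: adj_matrix_index)
    qed (use k pos in auto)
    then have "lam1 * \<nu> $ 0 > 0" unfolding row[symmetric] by (simp add: assms(9,11))
    then have lam1: "lam1 > 0" using pos[of 0] n(2) zero_less_mult_pos2 by fastforce
    have lam0: "lam \<ge> 0" by (simp add: assms(12))
    have lo: "\<nu>min\<^sup>2 \<le> (\<nu> $ i)\<^sup>2" and hi: "(\<nu> $ i)\<^sup>2 \<le> \<nu>max\<^sup>2" if "i < n" for i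
      using min_max[OF that] pos[OF that] min0 by (auto intro!: power_mono)
    have adj: "?A $$ (i, j) = 0" if "i < n" "j < n" "\<not> vs ! i \<rightarrow>\<^bsub>G\<^esub> vs ! j" for i j
      using that len by (simp add: adj_matrix_index)
    have nonneg: "\<nu> $ i \<ge> 0" if "i < n" for i using pos[OF that] by simp
    have ev0: "eigvals ?A ! 0 \<ge> 0" using lam1 by (simp add: assms(9,11))
    \<comment> \<open>Here \<open>lo\<close> and \<open>hi\<close> are the squares of
      \<open>\<nu>min\<close> and \<open>\<nu>max\<close>. The second conclusion gives (ii), the
      first one (iii).\<close>
    note bounds = zero_forcing_eigval_bounds[OF assms(1) vs len n(2) A adj_matrix_sym adj
        \<nu> nonneg ev0 zero_le_power2 lo hi B, folded t_def assms(9), folded assms(11,12)]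
    from bounds(2) have "t * ((lam + lam1) * \<nu>min\<^sup>2) \<le> 2 * lam" by (simp add: mult_ac add.commute)
    moreover have "(lam + lam1) * \<nu>min\<^sup>2 > 0" using lam1 lam0 min0 by simp
    ultimately have "t \<le> 2 * lam / ((lam + lam1) * \<nu>min\<^sup>2)" by (simp only: pos_le_divide_eq)
    also have "\<dots> = real n * (2 * lam / (real n * (lam + lam1) * \<nu>min ^ 2))"
      using n(2) by simp
    finally show ?thesis
      using ratio_power4_bound[OF bounds(1) min0 \<open>\<nu>min \<le> \<nu>max\<close> lam1 lam0 t0] by blast
  qed
  with 1 goal show ?thesis by blast
qed

end
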